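(* Let $n\ge 1$ and $m\ge 0$ be integers. Then $$\sum_{A} \operatorname{sgn}(A)\,(-1)^{\#\{\text{entries of }A\text{ decorated with the double arrow }\nwarrow\nearrow\}} \;=\; 2^n \prod_{i=1}^n \frac{(m-n+3i+1)_{i-1}\,(m-n+i+1)_i}{\left(\frac{m-n+i+2}{2}\right)_{i-1}\,(i)_i},$$ where the sum is over all arrowed Gelfand–Tsetlin patterns $A$ with $n$ rows whose entries are all integers in $\{0,1,\ldots,m\}$ and whose bottom row is strictly increasing.
   Context: A Gelfand–Tsetlin pattern with $n$ rows is a triangular array of integers $(a_{i,j})_{1\le j\le i\le n}$, row $i$ being $a_{i,1},\ldots,a_{i,i}$, drawn so that $a_{i-1,j}$ sits between $a_{i,j}$ and $a_{i,j+1}$, satisfying $a_{i+1,j}\le a_{i,j}\le a_{i+1,j+1}$ for all $1\le j\le i<n$. Row $n$ is the bottom row. For an entry $a_{i,j}$: its $\nwarrow$-neighbor is $a_{i-1,j-1}$ and its $\nearrow$-neighbor is $a_{i-1,j}$ (when they exist), its $\swarrow$-neighbor is $a_{i+1,j}$ and its $\searrow$-neighbor is $a_{i+1,j+1}$, and its left/right neighbors are $a_{i,j-1}$, $a_{i,j+1}$. An arrowed Gelfand–Tsetlin pattern is a Gelfand–Tsetlin pattern in which each entry either carries no decoration or carries exactly one decoration from $\{\nwarrow,\nearrow,\nwarrow\nearrow\}$ (the last one is called the double arrow), subject to: if an entry $a$ equals its $\nearrow$-neighbor and is decorated with $\nearrow$ or $\nwarrow\nearrow$, then the entry to the right of $a$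 in the same row also equals $a$ and is decorated with $\nwarrow$ or $\nwarrow\nearrow$; and if $a$ equals its $\nwarrow$-neighbor and is decorated with $\nwarrow$ or $\nwarrow\nearrow$, then the entry to the left of $a$ in the same row also equals $a$ and is decorated with $\nearrow$ or $\nwarrow\nearrow$. A special little triangle is an entry $a$ that equals both its $\swarrow$-neighbor $b$ and its $\searrow$-neighbor $c$, where $b$ is decorated with $\nearrow$ or $\nwarrow\nearrow$ and $c$ is decorated with $\nwarrow$ or $\nwarrow\nearrow$. The sign is $\operatorname{sgn}(A)=(-1)^{\#\text{special little triangles in }A}$. Pochhammer symbol: $(a)_k=a(a+1)\cdots(a+k-1)$, $(a)_0=1$. *)

theory Defs
  imports Complex_Main
begin

datatype arrow = NoArr | ArrNW | ArrNE | ArrDB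

text \<open>A pattern with n rows is given by a :: nat => nat => int, where a i j is the
  entry in row i (1 <= i <= n), position j (1 <= j <= i); d i j is its decoration.
  Outside the triangle, a is 0 and d is NoArr (so patterns are determined by their
  entries in the triangle).\<close>

definition in_tri :: "nat \<Rightarrow> nat \<Rightarrow> nat \<Rightarrow> bool" where
  "in_tri n i j \<longleftrightarrow> 1 \<le> j \<and> j \<le> i \<and> i \<le> n"

definition is_GT :: "nat \<Rightarrow> (nat \<Rightarrow> nat \<Rightarrow> int) \<Rightarrow> bool" where
  "is_GT n a \<longleftrightarrow> (\<forall>i j. 1 \<le> j \<and> j \<le> i \<and> i < n \<longrightarrow>
      a (i+1) j \<le> a i j \<and> a i j \<le> a (i+1) (j+1))"

definition has_NE :: "arrow \<Rightarrow> bool" where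
  "has_NE x \<longleftrightarrow> x = ArrNE \<or> x = ArrDB"

definition has_NW :: "arrow \<Rightarrow> bool" where
  "has_NW x \<longleftrightarrow> x = ArrNW \<or> x = ArrDB"

definition is_arrowed_GT :: "nat \<Rightarrow> (nat \<Rightarrow> nat \<Rightarrow> int) \<Rightarrow> (nat \<Rightarrow> nat \<Rightarrow> arrow) \<Rightarrow> bool" where
  "is_arrowed_GT n a d \<longleftrightarrow> is_GT n a \<and>
     (\<forall>i j. in_tri n i j \<and> 2 \<le> i \<and> j \<le> i - 1 \<and> a i j = a (i-1) j \<and> has_NE (d i j)
        \<longrightarrow> j + 1 \<le> i \<and> a i (j+1) = a i j \<and> has_NW (d i (j+1))) \<and>
     (\<forall>i j. in_tri n i j \<and> 2 \<le> i \<and> 2 \<le> j \<and> a i j = a (i-1) (j-1) \<and> has_NW (d i j)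
        \<longrightarrow> a i (j-1) = a i j \<and> has_NE (d i (j-1)))"

definition special_triangles :: "nat \<Rightarrow> (nat \<Rightarrow> nat \<Rightarrow> int) \<Rightarrow> (nat \<Rightarrow> nat \<Rightarrow> arrow) \<Rightarrow> (nat \<times> nat) set" where
  "special_triangles n a d = {(i, j). in_tri n i j \<and> i < n \<and>
      a i j = a (i+1) j \<and> a i j = a (i+1) (j+1) \<and> has_NE (d (i+1) j) \<and> has_NW (d (i+1) (j+1))}"

definition double_arrows :: "nat \<Rightarrow> (nat \<Rightarrow> nat \<Rightarrow> arrow) \<Rightarrow> (nat \<times> nat) set" where
  "double_arrows n d = {(i, j). in_tri n i j \<and> d i j = ArrDB}"

definition sgn_AGT :: "nat \<Rightarrow> (nat \<Rightarrow> nat \<Rightarrow> int) \<Rightarrow> (nat \<Rightarrow> nat \<Rightarrow> arrow) \<Rightarrow> int" where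
  "sgn_AGT n a d = (-1) ^ card (special_triangles n a d)"

definition AGT_set :: "nat \<Rightarrow> nat \<Rightarrow> ((nat \<Rightarrow> nat \<Rightarrow> int) \<times> (nat \<Rightarrow> nat \<Rightarrow> arrow)) set" where
  "AGT_set n m = {(a, d).
      (\<forall>i j. \<not> in_tri n i j \<longrightarrow> a i j = 0 \<and> d i j = NoArr) \<and>
      (\<forall>i j. in_tri n i j \<longrightarrow> 0 \<le> a i j \<and> a i j \<le> int m) \<and>
      (\<forall>j. 1 \<le> j \<and> j < n \<longrightarrow> a n j < a n (j+1)) \<and>
      is_arrowed_GT n a d}"

end

theory Submission
  imports Defs "Jordan_Normal_Form.Determinant" "HOL-Library.Landau_Symbols"
begin

text \<open>
  The conditions and signs attached to an arrowed row \<open>k\<close> are exactly those produced by the extended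
  sums over \<open>l\<^sub>i\<close> from \<open>k\<^sub>i + [NE]\<close> to \<open>k\<^bsub>i+1\<^esub> - [NW]\<close>. After giving row \<open>i\<close> a variable
  \<open>x\<^sub>i\<close> these sums are geometric, and the terms in which one slot of the row receives two variables
  cancel in pairs. So the patterns with bottom row \<open>k\<close> have generating function
  \<open>\<Prod> (x\<^sub>i + 1/x\<^sub>i)\<close> times the sum over all orderings of the variables of
  \<open>\<Prod>\<^bsub>i<j\<^esub> (1 - x\<^sub>i + x\<^sub>j + x\<^sub>i x\<^sub>j) / (x\<^sub>j - x\<^sub>i) \<cdot> \<Prod> x\<^sub>i^k\<^sub>i\<close>.
  Summing over strictly increasing \<open>k\<close> in \<open>{0..m}\<close> is a bounded Littlewood identity: up to explicit
  factors the result is \<open>det (v\<^sub>i^r - x\<^sub>i^M w\<^sub>i^r)\<close>, where \<open>M = m - n + 2\<close>,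
  \<open>v = (1 - x) / (x (1 + x))\<close> and \<open>w\<close> is the image of \<open>v\<close> under \<open>x \<mapsto> 1/x\<close>.

  Put \<open>y = v / (1 + v)\<^sup>2\<close>. Then \<open>x \<mapsto> 1/x\<close> is \<open>y \<mapsto> -y\<close> and \<open>x = (1 + w) / (1 + v)\<close>, so up to the
  factor \<open>(1 + v)^(-M)\<close> each entry is twice the odd part in \<open>y\<close> of \<open>v^r (1 + v)^M\<close>, whose Taylor
  coefficients are ballot numbers. Letting all \<open>x\<^sub>i\<close> tend to 1 leaves \<open>2^n\<close> times the determinant of the
  numbers \<open>(M + 2r) (M + 4l + 1)! / ((2l + 1 - r)! (M + 2l + 1 + r)!)\<close>. After extracting row and
  column factors, column \<open>r\<close> is a polynomial of degree \<open>n - 1\<close> evaluated at the points \<open>2l + 1\<close>, so the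
  determinant is a Vandermonde product times a constant; evaluating at \<open>0, \<dots>, n - 1\<close> instead, where
  the matrix is triangular, gives the constant.
\<close>

section \<open>Generating function by bottom row\<close>

text \<open>Extended summation: for \<open>b < c - 1\<close> it is minus the sum over the gap. On the rows of a pattern the
  gap has at most one element, and that element sits on top of a special little triangle.\<close>

definition esum :: "int \<Rightarrow> int \<Rightarrow> (int \<Rightarrow> real) \<Rightarrow> real" where
  "esum c b g = (\<Sum>l=c..b. g l) - (\<Sum>l=b+1..c-1. g l)"

definition ne_shift :: "arrow \<Rightarrow> int" where "ne_shift u = of_bool (has_NE u)"
definition nw_shift :: "arrow \<Rightarrow> int" where "nw_shift u = of_bool (has_NW u)"
definition arrow_wt :: "arrow \<Rightarrow> real" where "arrow_wt u = (if u = ArrDB then -1 else 1)"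

lemma UNIV_arrow: "UNIV = {NoArr, ArrNW, ArrNE, ArrDB}"
  using arrow.exhaust by auto

instance arrow :: finite
  by standard (simp add: UNIV_arrow)

lemma sum_arrow: "(\<Sum>u\<in>UNIV. f u) = f NoArr + f ArrNW + f ArrNE + f ArrDB"
  by (simp add: UNIV_arrow add.assoc)

lemma arrow_simps [simp]:
  "ne_shift NoArr = 0" "ne_shift ArrNW = 0" "ne_shift ArrNE = 1" "ne_shift ArrDB = 1"
  "nw_shift NoArr = 0" "nw_shift ArrNW = 1" "nw_shift ArrNE = 0" "nw_shift ArrDB = 1"
  "arrow_wt NoArr = 1" "arrow_wt ArrNW = 1" "arrow_wt ArrNE = 1" "arrow_wt ArrDB = -1"
  by (auto simp: ne_shift_def nw_shift_def arrow_wt_def has_NE_def has_NW_def)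

lemma sum_powi_atLeastAtMost:
  fixes y :: real
  assumes "c \<le> b + 1" "y \<noteq> 0" "y \<noteq> 1"
  shows "(\<Sum>l=c..b. y powi l) = (y powi (b+1) - y powi c) / (y - 1)"
proof -
  \<comment> \<open>The induction runs over the exclusive upper end \<open>b' = b + 1\<close>, so
    that its base case \<open>b' = c\<close> is the empty sum.\<close>
  have "(\<Sum>l=c..b'-1. y powi l) = (y powi b' - y powi c) / (y - 1)" if "c \<le> b'" for b'
    using that
  proof (induction b' rule: int_ge_induct)
    case (step i)
    have "{c..i + 1 - 1} = insert i {c..i-1}" using step.hyps by auto
    then have "(\<Sum>l=c..i+1-1. y powi l) = y powi i + (\<Sum>l=c..i-1. y powi l)" by simp
    also have "\<dots> = (y powi (i+1) - y powi c) / (y - 1)"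
      unfolding step.IH using assms by (simp add: power_int_add field_simps)
    finally show ?case .
  qed simp
  from this[of "b+1"] assms show ?thesis by simp
qed

text \<open>This is the reason for the sign convention in \<open>esum\<close>: the geometric formula
  holds without any condition on the order of the bounds.\<close>

lemma esum_powi:
  fixes y :: real
  assumes "y \<noteq> 0" "y \<noteq> 1"
  shows "esum c b (\<lambda>l. y powi l) = (y powi (b+1) - y powi c) / (y - 1)"
proof (cases "c \<le> b + 1")
  case True
  then have "{b+1..c-1} = {}" by auto
  then show ?thesis unfolding esum_def using sum_powi_atLeastAtMost[OF True assms] by simp
next
  case False
  then have "{c..b} = {}" by auto
  then show ?thesis unfolding esum_def using sum_powi_atLeastAtMost[of "b+1" "c-1" y] assms False
    by (simp add: field_simps)
qed

lemma esum_mult_left: "esum c b (\<lambda>l. a * g l) = a * esum c b g"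
  by (simp add: esum_def sum_distrib_left right_diff_distrib)

lemma esum_sum: "esum c b (\<lambda>l. \<Sum>i\<in>I. g i l) = (\<Sum>i\<in>I. esum c b (g i))"
proof -
  have *: "(\<Sum>l\<in>A. \<Sum>i\<in>I. g i l) = (\<Sum>i\<in>I. \<Sum>l\<in>A. g i l)" for A by (rule sum.swap)
  show ?thesis by (simp add: esum_def sum_subtractf *)
qed

text \<open>The slots of a row from left to right. The lower bound \<open>c\<close> for the entry above and to the left of the
  next slot carries the arrow of the slot before it; the function \<open>f\<close> is the generating function of the upper rows.\<close>

fun row_from :: "real \<Rightarrow> int \<Rightarrow> int list \<Rightarrow> (int list \<Rightarrow> real) \<Rightarrow> real" where
  "row_from z c [] f = f []"
| "row_from z c (k # ks) f = (\<Sum>u\<in>UNIV. arrow_wt u * z powi (k + ne_shift u - nw_shift u) *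
      esum c (k - nw_shift u) (\<lambda>l. z powi (-l) * row_from z (k + ne_shift u) ks (\<lambda>ls. f (l # ls))))"

text \<open>The first slot has no entry to its upper left, so only its arrow is summed. The value 0
  on the empty list is what \<open>row_from_sym_gf\<close> needs when no slot is left.\<close>

fun row_step :: "real \<Rightarrow> int list \<Rightarrow> (int list \<Rightarrow> real) \<Rightarrow> real" where
  "row_step z [] f = 0"
| "row_step z (k # ks) f = (\<Sum>u\<in>UNIV. arrow_wt u * z powi (k + ne_shift u - nw_shift u) * row_from z (k + ne_shift u) ks f)"

text \<open>The head of the list of variables belongs to the bottom row. Its exponent is the sum of
  that row minus the sum of the row above, plus the number of NE arrows, minus the number of NW
  arrows.\<close>

fun agt_gf :: "real list \<Rightarrow> int list \<Rightarrow> real" where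
  "agt_gf [] ks = 1"
| "agt_gf (z # zs) ks = row_step z ks (agt_gf zs)"

definition pair_wt :: "real \<Rightarrow> real \<Rightarrow> real" where "pair_wt x y = 1 - x + y + x * y"

definition head_wt :: "('i \<Rightarrow> real) \<Rightarrow> 'i \<Rightarrow> 'i set \<Rightarrow> real" where
  "head_wt x i I = (\<Prod>j\<in>I - {i}. pair_wt (x i) (x j) / (x j - x i))"

text \<open>When the list has \<open>card I\<close> entries, unfolding yields the sum over all
  orderings of the variables; \<open>head_wt\<close> collects the pair factors of the variable
  placed first.\<close>

fun sym_gf :: "('i \<Rightarrow> real) \<Rightarrow> 'i set \<Rightarrow> int list \<Rightarrow> real" where
  "sym_gf x I [] = 1"
| "sym_gf x I (k # ks) = (\<Sum>i\<in>I. x i powi k * head_wt x i I * sym_gf x (I - {i}) ks)"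

section \<open>Action of a row on symmetrized products\<close>

lemma row_from_cmult: "row_from z c ks (\<lambda>ls. a * f ls) = a * row_from z c ks f"
proof (induction ks arbitrary: c f)
  case (Cons k ks)
  have "(\<lambda>l. z powi (-l) * row_from z c' ks (\<lambda>ls. a * f (l # ls))) =
      (\<lambda>l. a * (z powi (-l) * row_from z c' ks (\<lambda>ls. f (l # ls))))" for c'
    by (simp only: Cons.IH mult_ac)
  then show ?case
    by (simp only: row_from.simps esum_mult_left sum_distrib_left mult_ac)
qed simp

lemma row_from_sum: "row_from z c ks (\<lambda>ls. \<Sum>i\<in>I. f i ls) = (\<Sum>i\<in>I. row_from z c ks (f i))"
proof (induction ks arbitrary: c f)
  case (Cons k ks)
  show ?case
    by (simp only: row_from.simps Cons.IH sum_distrib_left esum_sum) (rule sum.swap)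
qed simp

lemma row_step_cmult: "row_step z ks (\<lambda>ls. a * f ls) = a * row_step z ks f"
  by (cases ks) (simp_all add: row_from_cmult sum_distrib_left mult_ac)

text \<open>In the geometric sum for the next entry only the boundary term at its upper end is kept here, so that the
  first variable lands in the first slot of the list.\<close>

fun right_term :: "('i \<Rightarrow> real) \<Rightarrow> real \<Rightarrow> 'i set \<Rightarrow> int list \<Rightarrow> real" where
  "right_term x z I [] = 1"
| "right_term x z I (k # ks) = (\<Sum>u\<in>UNIV. arrow_wt u * z powi (k + ne_shift u - nw_shift u) *
     (\<Sum>i\<in>I. head_wt x i I * ((x i / z) powi (k - nw_shift u + 1) / (x i / z - 1)) *
        row_from z (k + ne_shift u) ks (sym_gf x (I - {i}))))"

text \<open>Each geometric sum has two boundary terms. The one at the lower end \<open>c\<close>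
  does not depend on the arrow of the current slot, so it factors out and leaves
  \<open>row_step\<close> for the remaining variables.\<close>

lemma row_from_sym_gf:
  assumes "z \<noteq> 0" "\<forall>i\<in>I. x i \<noteq> 0 \<and> x i \<noteq> z"
  shows "row_from z c ks (sym_gf x I) = right_term x z I ks -
    (\<Sum>i\<in>I. head_wt x i I * ((x i / z) powi c / (x i / z - 1)) * row_step z ks (sym_gf x (I - {i})))"
proof (cases ks)
  case (Cons k ks')
  have geo: "esum c b (\<lambda>l. z powi (-l) * (x i powi l * a)) =
      ((x i / z) powi (b+1) - (x i / z) powi c) / (x i / z - 1) * a" if "i \<in> I" for i b a
  proof -
    have "(\<lambda>l. z powi (-l) * (x i powi l * a)) = (\<lambda>l. a * (x i / z) powi l)"
      by (rule ext) (simp add: power_int_minus power_int_divide_distrib divide_simps)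
    moreover have "x i / z \<noteq> 0" "x i / z \<noteq> 1" using assms that by auto
    ultimately show ?thesis by (simp add: esum_mult_left esum_powi)
  qed
  have "row_from z c ks (sym_gf x I) = (\<Sum>u\<in>UNIV. arrow_wt u * z powi (k + ne_shift u - nw_shift u) *
      esum c (k - nw_shift u) (\<lambda>l. \<Sum>i\<in>I. z powi (-l) * (x i powi l * (head_wt x i I *
          row_from z (k + ne_shift u) ks' (sym_gf x (I - {i}))))))"
    by (simp add: Cons row_from_sum row_from_cmult sum_distrib_left mult.assoc)
  also have "\<dots> = (\<Sum>u\<in>UNIV. arrow_wt u * z powi (k + ne_shift u - nw_shift u) *
      (\<Sum>i\<in>I. ((x i / z) powi (k - nw_shift u + 1) - (x i / z) powi c) / (x i / z - 1) * (head_wt x i I *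
          row_from z (k + ne_shift u) ks' (sym_gf x (I - {i})))))"
    by (simp only: esum_sum) (intro sum.cong arg_cong2[where f = "(*)"] geo refl; simp)
  also have "\<dots> = right_term x z I ks -
    (\<Sum>i\<in>I. head_wt x i I * ((x i / z) powi c / (x i / z - 1)) * row_step z ks (sym_gf x (I - {i})))"
    by (simp add: Cons sum_distrib_left sum_subtractf[symmetric] sum.swap[of _ I] algebra_simps diff_divide_distrib)
  finally show ?thesis .
qed simp

text \<open>Since \<open>right_term\<close> does not involve \<open>c\<close>, the first arrow
  enters only through explicit powers. In one sum the double arrow cancels the undecorated entry,
  leaving \<open>z + 1/z\<close>; in the other the four arrows add up to
  \<open>pair_wt\<close>.\<close>

lemma row_step_sym_gf_Cons:
  assumes z: "z \<noteq> 0" and I: "\<forall>i\<in>I. x i \<noteq> 0 \<and> x i \<noteq> z"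
  shows "row_step z (k # ks) (sym_gf x I) = (z + 1/z) * z powi k * right_term x z I ks +
    (\<Sum>i\<in>I. x i powi k * (pair_wt (x i) z / (z - x i)) * head_wt x i I * row_step z ks (sym_gf x (I - {i})))"
proof -
  have 1: "(\<Sum>u\<in>UNIV. arrow_wt u * z powi (k + ne_shift u - nw_shift u)) = (z + 1/z) * z powi k"
    using z by (simp add: sum_arrow power_int_add power_int_diff field_simps)
  have 2: "(\<Sum>u\<in>UNIV. arrow_wt u * z powi (k + ne_shift u - nw_shift u) * ((x i / z) powi (k + ne_shift u) / (x i / z - 1)))
      = - (x i powi k * (pair_wt (x i) z / (z - x i)))" if "i \<in> I" for i
  proof -
    have nz: "z - x i \<noteq> 0" "x i - z \<noteq> 0" "x i \<noteq> 0" using I that by auto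
    show ?thesis
    using z nz by (simp add: sum_arrow power_int_add power_int_diff power_int_divide_distrib pair_wt_def divide_simps)
       (simp add: algebra_simps)
  qed
  have "row_step z (k # ks) (sym_gf x I) = (\<Sum>u\<in>UNIV. arrow_wt u * z powi (k + ne_shift u - nw_shift u)) * right_term x z I ks -
     (\<Sum>i\<in>I. (\<Sum>u\<in>UNIV. arrow_wt u * z powi (k + ne_shift u - nw_shift u) * ((x i / z) powi (k + ne_shift u) / (x i / z - 1)))
         * head_wt x i I * row_step z ks (sym_gf x (I - {i})))"
    unfolding row_step.simps row_from_sym_gf[OF z I]
    by (simp add: right_diff_distrib sum_subtractf sum_distrib_right sum_distrib_left sum.swap[of _ I] mult_ac)
  also have "\<dots> = (z + 1/z) * z powi k * right_term x z I ks +
    (\<Sum>i\<in>I. x i powi k * (pair_wt (x i) z / (z - x i)) * head_wt x i I * row_step z ks (sym_gf x (I - {i})))"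
    using 2 by (simp add: 1 sum_negf[symmetric])
  finally show ?thesis .
qed

lemma sum_offdiag_antisym:
  fixes f :: "'i \<Rightarrow> 'i \<Rightarrow> real"
  assumes "finite I" "\<And>i j. i \<in> I \<Longrightarrow> j \<in> I \<Longrightarrow> i \<noteq> j \<Longrightarrow> f i j = - f j i"
  shows "(\<Sum>i\<in>I. \<Sum>j\<in>I-{i}. f i j) = 0"
proof -
  have eq: "(\<Sum>i\<in>I. \<Sum>j\<in>I-{i}. f i j) = (\<Sum>i\<in>I. \<Sum>j\<in>I. if i = j then 0 else f i j)" (is "?S = ?T")
    by (intro sum.cong refl sum.mono_neutral_cong_left) (use assms(1) in auto)
  have "?T = (\<Sum>j\<in>I. \<Sum>i\<in>I. if i = j then 0 else f i j)" by (rule sum.swap)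
  also have "\<dots> = - ?T"
    unfolding sum_negf[symmetric]
  proof (intro sum.cong refl)
    fix j i assume "j \<in> I" "i \<in> I"
    with assms(2)[of i j] show "(if i = j then 0 else f i j) = - (if j = i then 0 else f j i)" by auto
  qed
  finally show ?thesis using eq by simp
qed

lemma head_wt_remove:
  assumes "finite I" "i \<in> I" "j \<in> I" "i \<noteq> j"
  shows "head_wt x i I = pair_wt (x i) (x j) / (x j - x i) * head_wt x i (I - {j})"
proof -
  have "I - {i} = insert j (I - {j} - {i})" using assms by auto
  then show ?thesis using assms(1) by (simp add: head_wt_def)
qed

text \<open>If the second variable also goes to the first slot, the term is antisymmetric in the two variables; only
  the terms in which all variables keep moving to their right neighbour survive.\<close>

lemma right_term_Cons:
  assumes z: "z \<noteq> 0" and fin: "finite I" and I: "\<forall>i\<in>I. x i \<noteq> 0 \<and> x i \<noteq> z"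
  shows "right_term x z I (k # ks) =
    (\<Sum>i\<in>I. x i powi k * (pair_wt z (x i) / (x i - z)) * head_wt x i I * right_term x z (I - {i}) ks)"
proof -
  let ?c = "\<lambda>u i. (x i / z) powi (k - nw_shift u + 1) / (x i / z - 1)"
  let ?d = "\<lambda>u j. (x j / z) powi (k + ne_shift u) / (x j / z - 1)"
  let ?D = "\<lambda>i j. \<Sum>u\<in>UNIV. arrow_wt u * z powi (k + ne_shift u - nw_shift u) * (?c u i * ?d u j)"
  have nz: "z - x i \<noteq> 0" "x i - z \<noteq> 0" "x i \<noteq> 0" if "i \<in> I" for i using I that by auto
  have 1: "(\<Sum>u\<in>UNIV. arrow_wt u * z powi (k + ne_shift u - nw_shift u) * ?c u i) =
      x i powi k * (pair_wt z (x i) / (x i - z))" if "i \<in> I" for i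
    using z nz[OF that]
    by (simp add: sum_arrow power_int_add power_int_diff power_int_divide_distrib pair_wt_def divide_simps)
       (simp add: algebra_simps)
  have 2: "?D i j = (x i * x j) powi k * z powi (-k) * (z * pair_wt (x j) (x i)) / ((x i - z) * (x j - z))"
    if "i \<in> I" "j \<in> I" for i j
    using z nz[OF that(1)] nz[OF that(2)]
    by (simp add: sum_arrow power_int_add power_int_diff power_int_divide_distrib power_int_mult_distrib power_int_minus pair_wt_def divide_simps)
       (simp add: algebra_simps)
  let ?f = "\<lambda>i j. head_wt x i I * head_wt x j (I - {i}) * ?D i j * row_step z ks (sym_gf x (I - {i} - {j}))"
  \<comment> \<open>By \<open>2\<close>, \<open>?D i j\<close> is symmetric except for
    \<open>pair_wt (x j) (x i)\<close>. Together with \<open>pair_wt (x i) (x j)\<close> from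
    \<open>head_wt\<close> this is symmetric too, so only the denominator \<open>x j - x i\<close>
    changes sign.\<close>
  have anti: "?f i j = - ?f j i" if "i \<in> I" "j \<in> I" "i \<noteq> j" for i j
  proof -
    have s: "I - {i} - {j} = I - {j} - {i}" by auto
    have e: "head_wt x i I * head_wt x j (I - {i}) * ?D i j =
      - (head_wt x j I * head_wt x i (I - {j}) * ?D j i)"
    proof -
      have "w / (x i - x j) = - (w / (x j - x i))" for w
        by (metis minus_diff_eq minus_divide_right)
      then show ?thesis
        unfolding 2[OF that(1,2)] 2[OF that(2,1)] head_wt_remove[OF fin that] head_wt_remove[OF fin that(2,1) that(3)[symmetric]]
          mult.commute[of "x j" "x i"]
        by (simp add: mult_ac)
    qed
    show ?thesis unfolding e s by simp
  qed
  have "right_term x z I (k # ks) = (\<Sum>u\<in>UNIV. arrow_wt u * z powi (k + ne_shift u - nw_shift u) *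
     (\<Sum>i\<in>I. head_wt x i I * ?c u i * (right_term x z (I - {i}) ks -
        (\<Sum>j\<in>I - {i}. head_wt x j (I - {i}) * ?d u j * row_step z ks (sym_gf x (I - {i} - {j}))))))"
    unfolding right_term.simps by (intro sum.cong refl arg_cong2[where f = "(*)"] row_from_sym_gf) (use z I in auto)
  also have "\<dots> = (\<Sum>i\<in>I. head_wt x i I * (\<Sum>u\<in>UNIV. arrow_wt u * z powi (k + ne_shift u - nw_shift u) * ?c u i) * right_term x z (I - {i}) ks) -
     (\<Sum>i\<in>I. \<Sum>j\<in>I-{i}. ?f i j)"
    by (simp add: right_diff_distrib sum_subtractf sum_distrib_right sum_distrib_left sum.swap[of _ _ "UNIV :: arrow set"] mult_ac)
  also have "(\<Sum>i\<in>I. \<Sum>j\<in>I-{i}. ?f i j) = 0"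
    using anti by (rule sum_offdiag_antisym[OF fin])
  also have "(\<Sum>i\<in>I. head_wt x i I * (\<Sum>u\<in>UNIV. arrow_wt u * z powi (k + ne_shift u - nw_shift u) * ?c u i) * right_term x z (I - {i}) ks)
    = (\<Sum>i\<in>I. x i powi k * (pair_wt z (x i) / (x i - z)) * head_wt x i I * right_term x z (I - {i}) ks)"
  proof (intro sum.cong refl)
    fix i assume "i \<in> I"
    show "head_wt x i I * (\<Sum>u\<in>UNIV. arrow_wt u * z powi (k + ne_shift u - nw_shift u) * ?c u i) * right_term x z (I - {i}) ks
      = x i powi k * (pair_wt z (x i) / (x i - z)) * head_wt x i I * right_term x z (I - {i}) ks"
      unfolding 1[OF \<open>i \<in> I\<close>] by (simp only: mult_ac)
  qed
  finally show ?thesis by simp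
qed

lemma right_term_eq:
  assumes z: "z \<noteq> 0" and "finite I" "\<forall>i\<in>I. x i \<noteq> 0 \<and> x i \<noteq> z" "length ks = card I"
  shows "right_term x z I ks = (\<Prod>i\<in>I. pair_wt z (x i) / (x i - z)) * sym_gf x I ks"
  using assms(2-)
proof (induction ks arbitrary: I)
  case (Cons k ks)
  have "right_term x z (I - {i}) ks = (\<Prod>i\<in>I-{i}. pair_wt z (x i) / (x i - z)) * sym_gf x (I - {i}) ks"
    if "i \<in> I" for i
    using Cons.prems that by (intro Cons.IH) auto
  then show ?case
    using Cons.prems(1)
    by (simp add: right_term_Cons[OF z Cons.prems(1,2)] sum_distrib_left prod.remove mult_ac del: right_term.simps)
qed simp

text \<open>The first entry of the row receives either the new variable, which gives the term
  evaluated by \<open>right_term_eq\<close>, or an old one, and then induction applies to the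
  remaining row.\<close>

theorem row_step_sym_gf:
  assumes "finite I" "i0 \<notin> I" "x i0 \<noteq> 0" "\<forall>i\<in>I. x i \<noteq> 0 \<and> x i \<noteq> x i0" "length ks = Suc (card I)"
  shows "row_step (x i0) ks (sym_gf x I) = (x i0 + 1 / x i0) * sym_gf x (insert i0 I) ks"
  using assms
proof (induction ks arbitrary: I)
  case (Cons k ks)
  let ?z = "x i0"
  have IH: "row_step ?z ks (sym_gf x (I - {i})) = (?z + 1 / ?z) * sym_gf x (insert i0 (I - {i})) ks"
    if "i \<in> I" for i
  proof (rule Cons.IH)
    show "length ks = Suc (card (I - {i}))"
      using Cons.prems(1,5) card.remove[OF Cons.prems(1) that] by simp
  qed (use Cons.prems that in auto)
  have h0: "head_wt x i0 (insert i0 I) = (\<Prod>i\<in>I. pair_wt ?z (x i) / (x i - ?z))"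
    using Cons.prems(2) by (simp add: head_wt_def)
  have h: "head_wt x i (insert i0 I) = pair_wt (x i) ?z / (?z - x i) * head_wt x i I"
      "insert i0 I - {i} = insert i0 (I - {i})" if "i \<in> I" for i
    using head_wt_remove[of "insert i0 I" i i0 x] Cons.prems that by auto
  have "sym_gf x (insert i0 I) (k # ks) = ?z powi k * right_term x ?z I ks +
      (\<Sum>i\<in>I. x i powi k * (pair_wt (x i) ?z / (?z - x i)) * head_wt x i I * sym_gf x (insert i0 (I - {i})) ks)"
    using Cons.prems by (simp add: right_term_eq h0 h mult_ac cong: sum.cong)
  then show ?case
    using Cons.prems IH by (simp add: row_step_sym_gf_Cons distrib_left sum_distrib_left mult_ac del: row_step.simps sym_gf.simps)
qed simp

lemma row_from_cong:
  "(\<And>ls. length ls = length ks \<Longrightarrow> f ls = g ls) \<Longrightarrow> row_from z c ks f = row_from z c ks g"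
proof (induction ks arbitrary: c f g)
  case (Cons k ks)
  have "row_from z c' ks (\<lambda>ls. f (l # ls)) = row_from z c' ks (\<lambda>ls. g (l # ls))" for c' l
    by (rule Cons.IH) (use Cons.prems in simp)
  then show ?case by simp
qed simp

lemma row_step_cong:
  "(\<And>ls. length ls = length ks - 1 \<Longrightarrow> f ls = g ls) \<Longrightarrow> row_step z ks f = row_step z ks g"
  by (cases ks) (auto intro!: sum.cong row_from_cong)

lemma agt_gf_eq:
  assumes "distinct is" "\<forall>i\<in>set is. x i \<noteq> 0" "inj_on x (set is)" "length ks = length is"
  shows "agt_gf (map x is) ks = (\<Prod>i\<in>set is. x i + 1 / x i) * sym_gf x (set is) ks"
  using assms
proof (induction "is" arbitrary: ks)
  case (Cons i js)
  have "row_step (x i) ks (agt_gf (map x js)) =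
      row_step (x i) ks (\<lambda>ls. (\<Prod>i\<in>set js. x i + 1 / x i) * sym_gf x (set js) ls)"
    by (rule row_step_cong, rule Cons.IH) (use Cons.prems in auto)
  also have "\<dots> = (\<Prod>i\<in>set js. x i + 1 / x i) * ((x i + 1 / x i) * sym_gf x (insert i (set js)) ks)"
    unfolding row_step_cmult using Cons.prems by (subst row_step_sym_gf) (auto simp: distinct_card intro: rev_image_eqI)
  finally show ?case using Cons.prems by (simp add: mult_ac)
qed simp

section \<open>Summation over strictly increasing bottom rows\<close>

definition strict_lists :: "nat \<Rightarrow> nat \<Rightarrow> int list set" where
  "strict_lists n N = {ks. length ks = n \<and> sorted_wrt (<) ks \<and> set ks \<subseteq> {0..<int N}}"

lemma finite_strict_lists [simp]: "finite (strict_lists n N)"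
  by (rule finite_subset[OF _ finite_lists_length_eq[of "{0..<int N}" n]])
     (auto simp: strict_lists_def)

lemma strict_lists_0 [simp]: "strict_lists 0 N = {[]}"
  by (auto simp: strict_lists_def)

lemma strict_lists_Suc_0 [simp]: "strict_lists (Suc n) 0 = {}"
  by (auto simp: strict_lists_def length_Suc_conv)

text \<open>Splitting by whether the smallest entry is 0 and shifting down yields a recursion in
  \<open>N\<close> that determines the sum over all bottom rows.\<close>

lemma strict_lists_Suc:
  "strict_lists (Suc n) (Suc N) =
     map (\<lambda>k. k + 1) ` strict_lists (Suc n) N \<union> (\<lambda>ks. 0 # map (\<lambda>k. k + 1) ks) ` strict_lists n N"
  (is "_ = ?A \<union> ?B")
proof (intro equalityI subsetI)
  fix ks assume "ks \<in> strict_lists (Suc n) (Suc N)"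
  then have len: "length ks = Suc n" and srt: "sorted_wrt (<) ks" and sub: "set ks \<subseteq> {0..<int (Suc N)}"
    by (auto simp: strict_lists_def)
  obtain k ls where ks: "ks = k # ls" using len by (cases ks) auto
  have gt: "k < l" if "l \<in> set ls" for l using srt that by (simp add: ks)
  have k0: "0 \<le> k" using sub by (simp add: ks)
  show "ks \<in> ?A \<union> ?B"
  proof (cases "k = 0")
    case True
    have "map (\<lambda>k. k - 1) ls \<in> strict_lists n N"
      using len srt sub gt by (fastforce simp: strict_lists_def ks sorted_wrt_map True)
    moreover have "ls = map (\<lambda>k. k + 1) (map (\<lambda>k. k - 1) ls)" by (simp add: o_def)
    ultimately show ?thesis unfolding ks True by blast
  next
    case False
    have "map (\<lambda>k. k - 1) ks \<in> strict_lists (Suc n) N"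
      using len srt sub gt False k0 by (fastforce simp: strict_lists_def sorted_wrt_map ks)
    moreover have "ks = map (\<lambda>k. k + 1) (map (\<lambda>k. k - 1) ks)" by (simp add: o_def)
    ultimately show ?thesis by blast
  qed
next
  fix ks assume "ks \<in> ?A \<union> ?B"
  then show "ks \<in> strict_lists (Suc n) (Suc N)"
    by (fastforce simp: strict_lists_def sorted_wrt_map intro: sorted_wrt_mono_rel[of _ "(<)"])
qed

lemma sum_strict_lists_Suc:
  fixes f :: "int list \<Rightarrow> real"
  shows "(\<Sum>ks\<in>strict_lists (Suc n) (Suc N). f ks) =
    (\<Sum>ks\<in>strict_lists (Suc n) N. f (map (\<lambda>k. k + 1) ks)) + (\<Sum>ks\<in>strict_lists n N. f (0 # map (\<lambda>k. k + 1) ks))"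
proof -
  have inj: "inj_on (map (\<lambda>k::int. k + 1)) A" for A
    by (rule inj_on_subset[OF inj_mapI]) (auto intro: injI)
  have "inj_on (\<lambda>ks. 0 # map (\<lambda>k::int. k + 1) ks) A" for A
    using inj by (auto simp: inj_on_def)
  moreover have "map (\<lambda>k. k + 1) ` strict_lists (Suc n) N \<inter> (\<lambda>ks. 0 # map (\<lambda>k. k + 1) ks) ` strict_lists n N = {}"
    by (auto simp: strict_lists_def length_Suc_conv)
  ultimately show ?thesis
    unfolding strict_lists_Suc by (subst sum.union_disjoint) (simp_all add: sum.reindex[OF inj] sum.reindex)
qed

text \<open>Because the list has \<open>card I\<close> entries, every ordering uses each variable
  once, so each term gains the full product.\<close>

lemma sym_gf_shift:
  assumes "finite I" "\<forall>i\<in>I. x i \<noteq> 0" "length ks = card I"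
  shows "sym_gf x I (map (\<lambda>k. k + 1) ks) = (\<Prod>i\<in>I. x i) * sym_gf x I ks"
  using assms
proof (induction ks arbitrary: I)
  case (Cons k ks)
  have "sym_gf x (I - {i}) (map (\<lambda>k. k + 1) ks) = (\<Prod>i\<in>I - {i}. x i) * sym_gf x (I - {i}) ks" if "i \<in> I" for i
    using Cons.prems that by (intro Cons.IH) auto
  then show ?case using Cons.prems
    by (auto simp: sum_distrib_left prod.remove power_int_add mult_ac intro!: sum.cong)
qed simp

definition strict_sum :: "(nat \<Rightarrow> real) \<Rightarrow> nat \<Rightarrow> nat set \<Rightarrow> real" where
  "strict_sum x N I = (\<Sum>ks\<in>strict_lists (card I) N. sym_gf x I ks)"

lemma strict_sum_empty [simp]: "strict_sum x N {} = 1"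
  by (simp add: strict_sum_def)

lemma strict_sum_0: "finite I \<Longrightarrow> I \<noteq> {} \<Longrightarrow> strict_sum x 0 I = 0"
  by (cases "card I") (auto simp: strict_sum_def)

text \<open>If the first entry is 0, its variable contributes no power, and the shift of the other
  entries puts \<open>x j\<close> into each factor of \<open>head_wt\<close>.\<close>

lemma strict_sum_Suc:
  assumes "finite I" "I \<noteq> {}" "\<forall>i\<in>I. x i \<noteq> 0"
  shows "strict_sum x (Suc N) I = (\<Prod>i\<in>I. x i) * strict_sum x N I +
    (\<Sum>i\<in>I. (\<Prod>j\<in>I-{i}. x j * (pair_wt (x i) (x j) / (x j - x i))) * strict_sum x N (I - {i}))"
proof -
  obtain n where n: "card I = Suc n" using assms by (cases "card I") auto
  have c: "card (I - {i}) = n" if "i \<in> I" for i using n that assms(1) by simp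
  have "sym_gf x (I - {i}) (map (\<lambda>k. k + 1) ks) = (\<Prod>j\<in>I-{i}. x j) * sym_gf x (I - {i}) ks"
    if "i \<in> I" "ks \<in> strict_lists n N" for i ks
    using that assms c by (intro sym_gf_shift) (auto simp: strict_lists_def)
  then have "(\<Sum>ks\<in>strict_lists n N. sym_gf x I (0 # map (\<lambda>k. k + 1) ks)) =
      (\<Sum>ks\<in>strict_lists n N. \<Sum>i\<in>I. (\<Prod>j\<in>I-{i}. x j * (pair_wt (x i) (x j) / (x j - x i))) * sym_gf x (I - {i}) ks)"
    by (auto simp: head_wt_def prod.distrib mult_ac prod_dividef intro!: sum.cong)
  also have "\<dots> = (\<Sum>i\<in>I. (\<Prod>j\<in>I-{i}. x j * (pair_wt (x i) (x j) / (x j - x i))) * strict_sum x N (I - {i}))"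
    by (subst sum.swap) (auto simp: strict_sum_def c n sum_distrib_left intro!: sum.cong)
  finally have 2: "(\<Sum>ks\<in>strict_lists n N. sym_gf x I (0 # map (\<lambda>k. k + 1) ks)) =
     (\<Sum>i\<in>I. (\<Prod>j\<in>I-{i}. x j * (pair_wt (x i) (x j) / (x j - x i))) * strict_sum x N (I - {i}))" .
  have 1: "(\<Sum>ks\<in>strict_lists (Suc n) N. sym_gf x I (map (\<lambda>k. k + 1) ks)) = (\<Prod>i\<in>I. x i) * strict_sum x N I"
    unfolding strict_sum_def n sum_distrib_left
    by (intro sum.cong refl sym_gf_shift) (use assms n in \<open>auto simp: strict_lists_def\<close>)
  show ?thesis unfolding strict_sum_def[of x "Suc N"] n sum_strict_lists_Suc 1 2 ..
qed

section \<open>A subset expansion with the same recursion\<close>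

definition pairs :: "nat set \<Rightarrow> (nat \<times> nat) set" where
  "pairs I = {(i, j). i \<in> I \<and> j \<in> I \<and> i < j}"

lemma finite_pairs [simp]: "finite I \<Longrightarrow> finite (pairs I)"
  by (rule finite_subset[of _ "I \<times> I"]) (auto simp: pairs_def)

lemma pairs_empty [simp]: "pairs {} = {}"
  by (simp add: pairs_def)

lemma prod_pairs_remove:
  fixes f :: "nat \<Rightarrow> nat \<Rightarrow> real"
  assumes "finite I" "i \<in> I" "\<And>j. j \<in> I \<Longrightarrow> f i j = f j i"
  shows "(\<Prod>(a, b)\<in>pairs I. f a b) = (\<Prod>(a, b)\<in>pairs (I - {i}). f a b) * (\<Prod>j\<in>I-{i}. f i j)"
proof -
  define g where "g = (\<lambda>j. if i < j then (i, j) else (j, i))"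
  have "pairs I = pairs (I - {i}) \<union> g ` (I - {i})"
    using assms(2) by (auto simp: pairs_def image_iff g_def)
  moreover have "pairs (I - {i}) \<inter> g ` (I - {i}) = {}"
    by (auto simp: pairs_def g_def)
  moreover have "inj_on g (I - {i})" by (auto simp: inj_on_def g_def split: if_splits)
  ultimately have "(\<Prod>(a, b)\<in>pairs I. f a b) =
     (\<Prod>(a, b)\<in>pairs (I - {i}). f a b) * (\<Prod>j\<in>I-{i}. case g j of (a, b) \<Rightarrow> f a b)"
    using assms(1) by (simp add: prod.union_disjoint prod.reindex)
  also have "(\<Prod>j\<in>I-{i}. case g j of (a, b) \<Rightarrow> f a b) = (\<Prod>j\<in>I-{i}. f i j)"
    using assms(3) by (intro prod.cong) (auto simp: g_def)
  finally show ?thesis .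
qed

text \<open>Lagrange interpolation of \<open>P - Q\<close> at the nodes \<open>p i\<close>,
  evaluated at 0. Both products are monic of degree \<open>card T\<close>, so their difference has
  smaller degree, and \<open>Q\<close> vanishes at the nodes.\<close>

lemma sum_one_minus_interpolation:
  fixes p x :: "'i \<Rightarrow> real"
  assumes fin: "finite T" and inj: "inj_on p T" and nz: "\<forall>i\<in>T. p i \<noteq> 0"
  shows "(\<Sum>i\<in>T. (1 - x i) * (\<Prod>j\<in>T-{i}. (p i - x j * p j) / (p i - p j))) = 1 - (\<Prod>i\<in>T. x i)"
proof (cases "T = {}")
  case False
  define P Q L where "P = (\<Prod>j\<in>T. [:- (x j * p j), 1:])" and "Q = (\<Prod>j\<in>T. [:- p j, 1:])"
    and "L = (\<Sum>i\<in>T. smult ((\<Prod>j\<in>T. p i - x j * p j) / (\<Prod>j\<in>T-{i}. p i - p j)) (\<Prod>j\<in>T-{i}. [:- p j, 1:]))"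
  have deg: "degree (\<Prod>j\<in>A. [:- w j, 1:]) = card A" if "finite A" for w :: "'i \<Rightarrow> real" and A
    using that by (subst degree_prod_eq_sum_degree) auto
  have lc: "coeff (\<Prod>j\<in>T. [:- w j, 1:]) (card T) = 1" for w :: "'i \<Rightarrow> real"
    using lead_coeff_prod[of "\<lambda>j. [:- w j, 1:]" T] deg[OF fin, of w] by simp
  have degL: "degree L < card T"
  proof -
    have "degree L \<le> card T - 1"
      unfolding L_def
    proof (rule degree_sum_le[OF fin])
      fix i assume "i \<in> T"
      then show "degree (smult ((\<Prod>j\<in>T. p i - x j * p j) / (\<Prod>j\<in>T-{i}. p i - p j)) (\<Prod>j\<in>T-{i}. [:- p j, 1:])) \<le> card T - 1"
        using fin deg[of "T - {i}" p] by (intro order.trans[OF degree_smult_le]) simp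
    qed
    then show ?thesis using False fin by (metis Suc_pred' card_gt_0_iff less_Suc_eq_le)
  qed
  have "degree (P - Q) \<le> card T"
    unfolding P_def Q_def by (rule degree_diff_le) (simp_all add: deg fin)
  moreover have "coeff (P - Q) (card T) = 0" unfolding P_def Q_def by (simp add: lc)
  ultimately have "P - Q = 0 \<or> degree (P - Q) < card T" by (rule eq_zero_or_degree_less)
  then have degPQ: "degree (P - Q) < card T" using False fin by (auto simp: card_gt_0_iff)
  have "P - Q = L"
  proof (rule poly_eqI_degree[of "p ` T"])
    fix w assume "w \<in> p ` T"
    then obtain i where i: "i \<in> T" "w = p i" by auto
    have "poly L w = (\<Sum>m\<in>T. if m = i then (\<Prod>j\<in>T. p i - x j * p j) else 0)"
      unfolding L_def poly_sum
    proof (intro sum.cong refl)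
      fix m assume m: "m \<in> T"
      have "(\<Prod>j\<in>T-{i}. p i - p j) \<noteq> 0"
        using inj i fin by (auto simp: inj_on_def)
      moreover have "(\<Prod>j\<in>T-{m}. p i - p j) = 0" if "m \<noteq> i"
        using i that fin by (auto intro!: prod_zero)
      ultimately show "poly (smult ((\<Prod>j\<in>T. p m - x j * p j) / (\<Prod>j\<in>T-{m}. p m - p j)) (\<Prod>j\<in>T-{m}. [:- p j, 1:])) w =
          (if m = i then (\<Prod>j\<in>T. p i - x j * p j) else 0)"
        by (auto simp: poly_prod i)
    qed
    also have "\<dots> = (\<Prod>j\<in>T. p i - x j * p j)" using fin i by simp
    also have "\<dots> = poly (P - Q) w"
      using fin i by (auto simp: P_def Q_def poly_prod intro!: prod_zero)
    finally show "poly (P - Q) w = poly L w" by simp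
  qed (use degL degPQ inj in \<open>simp_all add: card_image\<close>)
  then have "poly (P - Q) 0 = poly L 0" by simp
  moreover have "poly (P - Q) 0 = (- 1) ^ card T * (\<Prod>j\<in>T. p j) * ((\<Prod>j\<in>T. x j) - 1)"
    by (simp add: P_def Q_def poly_prod prod.distrib prod_uminus algebra_simps)
  moreover have "poly L 0 = (\<Sum>i\<in>T. - ((- 1) ^ card T * (\<Prod>j\<in>T. p j)) * ((1 - x i) * (\<Prod>j\<in>T-{i}. (p i - x j * p j) / (p i - p j))))"
    unfolding L_def poly_sum
  proof (intro sum.cong refl)
    fix i assume i: "i \<in> T"
    have c: "card T = Suc (card (T - {i}))" using card.remove[OF fin i] .
    show "poly (smult ((\<Prod>j\<in>T. p i - x j * p j) / (\<Prod>j\<in>T-{i}. p i - p j)) (\<Prod>j\<in>T-{i}. [:- p j, 1:])) 0 =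
      - ((- 1) ^ card T * (\<Prod>j\<in>T. p j)) * ((1 - x i) * (\<Prod>j\<in>T-{i}. (p i - x j * p j) / (p i - p j)))"
    proof -
      have "p i - x i * p i = p i * (1 - x i)" by (simp add: algebra_simps)
      then show ?thesis
        unfolding c prod.remove[OF fin i] prod_dividef by (simp add: poly_prod prod_uminus)
    qed
  qed
  ultimately have "(- 1) ^ card T * (\<Prod>j\<in>T. p j) * ((\<Prod>j\<in>T. x j) - 1) =
     - ((- 1) ^ card T * (\<Prod>j\<in>T. p j)) * (\<Sum>i\<in>T. (1 - x i) * (\<Prod>j\<in>T-{i}. (p i - x j * p j) / (p i - p j)))"
    by (simp add: sum_distrib_left)
  moreover have "(- 1) ^ card T * (\<Prod>j\<in>T. p j) \<noteq> 0" using nz fin by simp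
  ultimately have "(\<Prod>j\<in>T. x j) - 1 = - (\<Sum>i\<in>T. (1 - x i) * (\<Prod>j\<in>T-{i}. (p i - x j * p j) / (p i - p j)))"
    by (metis (no_types, lifting) minus_mult_commute mult_left_cancel)
  then show ?thesis by simp
qed simp

text \<open>The number \<open>1 + v\<close>; moreover \<open>x (1 + v) = 1 + w\<close>.\<close>

definition node_val :: "real \<Rightarrow> real" where "node_val x = (1 + x\<^sup>2) / (x * (1 + x))"

definition pair_kernel :: "real \<Rightarrow> real \<Rightarrow> real" where "pair_kernel x y = (1 + x + y - x * y) / (1 - x * y)"

lemma mult_lt_1: "0 < x \<Longrightarrow> x < 1 \<Longrightarrow> 0 < y \<Longrightarrow> y < 1 \<Longrightarrow> x * y < (1::real)"
  using mult_strict_mono[of x 1 y 1] by simp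

text \<open>Splits the factor in \<open>strict_sum_Suc\<close> into a symmetric kernel and a
  quotient of the shape in \<open>sum_one_minus_interpolation\<close>, with nodes
  \<open>node_val (x i)\<close>. The second identity shows that these nodes are distinct.\<close>

lemma pair_wt_factor:
  assumes "0 < x" "x < 1" "0 < y" "y < 1" "x \<noteq> y"
  shows "y * (pair_wt x y / (y - x)) = pair_kernel x y * ((node_val x - y * node_val y) / (node_val x - node_val y))"
    and "node_val x - node_val y = (y - x) * (1 + x + y - x * y) / (x * y * (1 + x) * (1 + y))"
proof -
  have xy: "x * y < 1" using assms by (simp add: mult_lt_1)
  have pos: "0 < 1 + x + y - x * y" using xy assms by simp
  show 1: "node_val x - node_val y = (y - x) * (1 + x + y - x * y) / (x * y * (1 + x) * (1 + y))"
    using assms by (simp add: node_val_def divide_simps power2_eq_square) (simp add: algebra_simps)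
  have 2: "node_val x - y * node_val y = pair_wt x y * (1 - x * y) / (x * (1 + x) * (1 + y))"
    using assms by (simp add: node_val_def pair_wt_def divide_simps power2_eq_square) (simp add: algebra_simps)
  show "y * (pair_wt x y / (y - x)) = pair_kernel x y * ((node_val x - y * node_val y) / (node_val x - node_val y))"
    unfolding 1 2 pair_kernel_def using assms xy pos by (simp add: divide_simps)
qed

lemma inj_on_node_val: "inj_on x I \<Longrightarrow> \<forall>i\<in>I. 0 < x i \<and> x i < 1 \<Longrightarrow> inj_on (\<lambda>i. node_val (x i)) I"
proof (rule inj_onI, rule ccontr)
  fix i j assume a: "inj_on x I" "\<forall>i\<in>I. 0 < x i \<and> x i < 1" "i \<in> I" "j \<in> I" "node_val (x i) = node_val (x j)" "i \<noteq> j"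
  then have ne_shift: "x i \<noteq> x j" by (auto simp: inj_on_def)
  have "x i * x j < 1" using a by (simp add: mult_lt_1)
  moreover have "x i > 0" "x j > 0" using a(2-4) by auto
  ultimately have "1 + x i + x j - x i * x j > 0" by linarith
  with pair_wt_factor(2)[of "x i" "x j"] a ne_shift show False by auto
qed

text \<open>For \<open>x > 0\<close>, \<open>x * node_val x\<close> is
  \<open>node_val (1 / x)\<close>, so the variables indexed by \<open>S\<close> are
  inverted.\<close>

definition swap_val :: "(nat \<Rightarrow> real) \<Rightarrow> nat set \<Rightarrow> nat \<Rightarrow> real" where
  "swap_val x S i = (if i \<in> S then x i * node_val (x i) else node_val (x i))"

text \<open>The expansion of \<open>det (v\<^sub>i^r - x\<^sub>i^e w\<^sub>i^r)\<close> over the set of rows from which the second summand is taken,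
  divided by the Vandermonde product of the \<open>v\<^sub>i\<close>.\<close>

definition subset_sum :: "(nat \<Rightarrow> real) \<Rightarrow> int \<Rightarrow> nat set \<Rightarrow> real" where
  "subset_sum x e I = (\<Sum>S\<in>Pow I. (\<Prod>i\<in>S. - (x i powi e)) *
      (\<Prod>(i, j)\<in>pairs I. (swap_val x S j - swap_val x S i) / (node_val (x j) - node_val (x i))))"

text \<open>The part that does not depend on the subset. Its factors \<open>1 / (1 - x i)\<close>
  absorb the \<open>1 - x i\<close> of the interpolation identity.\<close>

definition subset_factor :: "(nat \<Rightarrow> real) \<Rightarrow> nat set \<Rightarrow> real" where
  "subset_factor x I = (\<Prod>i\<in>I. 1 / (1 - x i)) * (\<Prod>(i, j)\<in>pairs I. pair_kernel (x i) (x j))"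

text \<open>This is the recursion of \<open>strict_sum_Suc\<close>. For a fixed subset
  \<open>S\<close> the removed index runs over \<open>I - S\<close>, and interpolation replaces that
  sum by \<open>1 - (\<Prod>i\<in>I-S. x i)\<close>: the 1 gives the exponent \<open>e + 1\<close>,
  the product the exponent \<open>e\<close>.\<close>

lemma subset_sum_rec:
  assumes fin: "finite I" and x: "\<forall>i\<in>I. 0 < x i \<and> x i < 1" and inj: "inj_on x I"
  shows "subset_factor x I * subset_sum x (e + 1) I = (\<Prod>i\<in>I. x i) * (subset_factor x I * subset_sum x e I) +
    (\<Sum>i\<in>I. (\<Prod>j\<in>I-{i}. x j * (pair_wt (x i) (x j) / (x j - x i))) * (subset_factor x (I - {i}) * subset_sum x (e + 1) (I - {i})))"
proof -
  let ?p = "\<lambda>i. node_val (x i)"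
  let ?q = "\<lambda>i j. (?p i - x j * ?p j) / (?p i - ?p j)"
  let ?f = "\<lambda>S i j. (swap_val x S j - swap_val x S i) / (?p j - ?p i)"
  let ?R = "\<lambda>S I. \<Prod>(i, j)\<in>pairs I. ?f S i j"
  let ?W = "\<lambda>e S. \<Prod>i\<in>S. - (x i powi e)"
  note injp = inj_on_node_val[OF inj x]
  have nz: "?p i - ?p j \<noteq> 0" if "i \<in> I" "j \<in> I" "i \<noteq> j" for i j
    using injp that by (auto simp: inj_on_def)
  have fsym: "?f S i j = ?f S j i" for S i j
    using minus_divide_divide[of "swap_val x S j - swap_val x S i" "?p j - ?p i"] by (simp only: minus_diff_eq)
  have ksym: "pair_kernel a b = pair_kernel b a" for a b by (simp add: pair_kernel_def ac_simps)
  have R: "?R S I = ?R S (I - {i}) * (\<Prod>j\<in>I-{i}. ?f S i j)" if "i \<in> I" for i S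
    by (rule prod_pairs_remove[OF fin that fsym])
  have K: "subset_factor x I = subset_factor x (I - {i}) * (1 / (1 - x i)) * (\<Prod>j\<in>I-{i}. pair_kernel (x i) (x j))" if "i \<in> I" for i
    unfolding subset_factor_def prod.remove[OF fin that]
      prod_pairs_remove[OF fin that, of "\<lambda>i j. pair_kernel (x i) (x j)", OF ksym] by (simp only: mult_ac)
  have summand: "(\<Prod>j\<in>I-{i}. x j * (pair_wt (x i) (x j) / (x j - x i))) * (subset_factor x (I - {i}) * subset_sum x (e + 1) (I - {i})) =
     subset_factor x I * (\<Sum>S\<in>Pow (I - {i}). ?W (e+1) S * ?R S I * ((1 - x i) * (\<Prod>j\<in>I-S-{i}. ?q i j)))"
    if i: "i \<in> I" for i
  proof -
    let ?B = "subset_factor x (I - {i})" and ?Z = "subset_sum x (e + 1) (I - {i})"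
    have 1: "(\<Prod>j\<in>I-{i}. x j * (pair_wt (x i) (x j) / (x j - x i))) = (\<Prod>j\<in>I-{i}. pair_kernel (x i) (x j)) * (\<Prod>j\<in>I-{i}. ?q i j)"
      unfolding prod.distrib[symmetric]
      using i x inj by (intro prod.cong refl pair_wt_factor(1)) (auto simp: inj_on_def)
    have 2: "?B * (\<Prod>j\<in>I-{i}. pair_kernel (x i) (x j)) = subset_factor x I * (1 - x i)"
      using x i unfolding K[OF i] by (auto simp: field_simps)
    have "(\<Prod>j\<in>I-{i}. x j * (pair_wt (x i) (x j) / (x j - x i))) * (?B * ?Z) =
       (?B * (\<Prod>j\<in>I-{i}. pair_kernel (x i) (x j))) * ((\<Prod>j\<in>I-{i}. ?q i j) * ?Z)"
      unfolding 1 by (simp only: mult_ac)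
    then have "(\<Prod>j\<in>I-{i}. x j * (pair_wt (x i) (x j) / (x j - x i))) * (?B * ?Z) =
       subset_factor x I * ((1 - x i) * ((\<Prod>j\<in>I-{i}. ?q i j) * ?Z))"
      unfolding 2 by (simp only: mult.assoc)
    moreover have "(\<Prod>j\<in>I-{i}. ?q i j) * subset_sum x (e + 1) (I - {i}) =
      (\<Sum>S\<in>Pow (I - {i}). ?W (e+1) S * ?R S I * (\<Prod>j\<in>I-S-{i}. ?q i j))"
      unfolding subset_sum_def sum_distrib_left
    proof (intro sum.cong refl)
      fix S assume S: "S \<in> Pow (I - {i})"
      \<comment> \<open>Here \<open>i\<close> is not in \<open>S\<close>. For \<open>j\<close> in
        \<open>S\<close> the quotient \<open>?q i j\<close> is the missing pair factor
        \<open>?f S i j\<close>, and for other \<open>j\<close> that factor is 1. Hence the product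
        over pairs of \<open>I - {i}\<close> is completed to one over pairs of \<open>I\<close>, and
        only the quotients outside \<open>S\<close> remain.\<close>
      have split: "I - {i} = S \<union> (I - S - {i})" using S by auto
      have "(\<Prod>j\<in>I-{i}. ?q i j) = (\<Prod>j\<in>S. ?q i j) * (\<Prod>j\<in>I-S-{i}. ?q i j)"
        using S fin by (subst split, subst prod.union_disjoint) (auto intro: finite_subset)
      moreover have "(\<Prod>j\<in>I-{i}. ?f S i j) = (\<Prod>j\<in>S. ?f S i j) * (\<Prod>j\<in>I-S-{i}. ?f S i j)"
        using S fin by (subst split, subst prod.union_disjoint) (auto intro: finite_subset)
      moreover have "(\<Prod>j\<in>I-S-{i}. ?f S i j) = 1"
        using S nz[OF i] by (intro prod.neutral) (force simp: swap_val_def)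
      moreover have "(\<Prod>j\<in>S. ?f S i j) = (\<Prod>j\<in>S. ?q i j)"
      proof (intro prod.cong refl)
        fix j assume "j \<in> S"
        then show "?f S i j = ?q i j"
          using S minus_divide_divide[of "?p i - x j * ?p j" "?p i - ?p j"] by (auto simp: swap_val_def)
      qed
      ultimately show "(\<Prod>j\<in>I-{i}. ?q i j) * (?W (e+1) S * ?R S (I - {i})) =
          ?W (e+1) S * ?R S I * (\<Prod>j\<in>I-S-{i}. ?q i j)"
        unfolding R[OF i, of S] by (simp only: mult_ac mult_1_right)
    qed
    ultimately show ?thesis by (simp only: sum_distrib_left mult_ac)
  qed
  have "(\<Sum>i\<in>I. \<Sum>S\<in>Pow (I - {i}). ?W (e+1) S * ?R S I * ((1 - x i) * (\<Prod>j\<in>I-S-{i}. ?q i j))) =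
     (\<Sum>S\<in>Pow I. \<Sum>i\<in>I-S. ?W (e+1) S * ?R S I * ((1 - x i) * (\<Prod>j\<in>I-S-{i}. ?q i j)))"
    using fin by (subst (1 2) sum.Sigma) (auto intro!: sum.reindex_bij_witness[of _ prod.swap prod.swap])
  also have "\<dots> = (\<Sum>S\<in>Pow I. ?W (e+1) S * ?R S I * (1 - (\<Prod>i\<in>I-S. x i)))"
  proof (intro sum.cong refl)
    fix S assume "S \<in> Pow I"
    have "?p i \<noteq> 0" if "i \<in> I" for i
    proof -
      have "0 < x i" using x that by auto
      then have "1 + (x i)\<^sup>2 > 0" by (simp add: add_pos_pos)
      then show ?thesis using \<open>0 < x i\<close> by (simp add: node_val_def)
    qed
    then have "(\<Sum>i\<in>I-S. (1 - x i) * (\<Prod>j\<in>I-S-{i}. ?q i j)) = 1 - (\<Prod>i\<in>I-S. x i)"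
      using fin injp by (intro sum_one_minus_interpolation) (auto intro: inj_on_subset)
    then show "(\<Sum>i\<in>I-S. ?W (e+1) S * ?R S I * ((1 - x i) * (\<Prod>j\<in>I-S-{i}. ?q i j))) =
        ?W (e+1) S * ?R S I * (1 - (\<Prod>i\<in>I-S. x i))"
      by (simp add: sum_distrib_left[symmetric])
  qed
  also have "\<dots> = subset_sum x (e + 1) I - (\<Sum>S\<in>Pow I. ?W (e+1) S * ?R S I * (\<Prod>i\<in>I-S. x i))"
    by (simp add: subset_sum_def right_diff_distrib sum_subtractf)
  \<comment> \<open>The variables outside \<open>S\<close> come from the interpolation; those in
    \<open>S\<close> are split off when the exponent drops by one. Together they form the product
    over \<open>I\<close>.\<close>
  also have "(\<Sum>S\<in>Pow I. ?W (e+1) S * ?R S I * (\<Prod>i\<in>I-S. x i)) = (\<Prod>i\<in>I. x i) * subset_sum x e I"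
    unfolding subset_sum_def sum_distrib_left
  proof (intro sum.cong refl)
    fix S assume S: "S \<in> Pow I"
    have "?W (e+1) S = (\<Prod>i\<in>S. x i) * ?W e S"
      unfolding prod.distrib[symmetric]
    proof (intro prod.cong refl)
      fix i assume "i \<in> S"
      then have "x i > 0" using S x by auto
      then show "- (x i powi (e + 1)) = x i * - (x i powi e)" by (simp add: power_int_add)
    qed
    moreover have "(\<Prod>i\<in>I. x i) = (\<Prod>i\<in>I-S. x i) * (\<Prod>i\<in>S. x i)"
      using prod.subset_diff[of S I x] S fin by auto
    ultimately have "?W (e+1) S * (\<Prod>i\<in>I-S. x i) = (\<Prod>i\<in>I. x i) * ?W e S"
      by (simp only: mult_ac)
    then have "(?W (e+1) S * (\<Prod>i\<in>I-S. x i)) * ?R S I = ((\<Prod>i\<in>I. x i) * ?W e S) * ?R S I"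
      by (rule arg_cong)
    then show "?W (e+1) S * ?R S I * (\<Prod>i\<in>I-S. x i) = (\<Prod>i\<in>I. x i) * (?W e S * ?R S I)"
      by (simp only: mult_ac)
  qed
  finally have "(\<Sum>i\<in>I. subset_factor x I * (\<Sum>S\<in>Pow (I - {i}). ?W (e+1) S * ?R S I * ((1 - x i) * (\<Prod>j\<in>I-S-{i}. ?q i j))))
     = subset_factor x I * (subset_sum x (e + 1) I - (\<Prod>i\<in>I. x i) * subset_sum x e I)"
    by (simp only: sum_distrib_left[symmetric])
  note main = trans[OF sum.cong[OF refl summand] this]
  show ?thesis
    by (subst main) (assumption, simp add: algebra_simps)
qed

section \<open>Determinants\<close>

lemma det_eq_prod_diag:
  fixes A :: "real mat"
  assumes "A \<in> carrier_mat n n"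
    "(\<forall>i<n. \<forall>j<i. A $$ (i,j) = 0) \<or> (\<forall>j<n. \<forall>i<j. A $$ (i,j) = 0)"
  shows "det A = (\<Prod>i<n. A $$ (i,i))"
proof -
  have "det A = prod_list (diag_mat A)"
    using assms(2)
  proof
    assume "\<forall>i<n. \<forall>j<i. A $$ (i,j) = 0"
    then show ?thesis using assms(1) by (intro det_upper_triangular[of A n]) auto
  next
    assume "\<forall>j<n. \<forall>i<j. A $$ (i,j) = 0"
    then show ?thesis using assms(1) by (intro det_lower_triangular[of n A]) auto
  qed
  then show ?thesis using assms(1)
    by (simp add: diag_mat_def prod.list_conv_set_nth atLeast0LessThan)
qed

text \<open>The evaluation matrix is a Vandermonde matrix times the coefficient matrix, so the nodes
  enter the determinant only through the Vandermonde factor.\<close>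

lemma det_poly_eval:
  fixes f :: "nat \<Rightarrow> real poly"
  assumes "\<And>r. r < n \<Longrightarrow> degree (f r) < n"
  shows "det (mat n n (\<lambda>(i, r). poly (f r) (w i))) =
    det (mat n n (\<lambda>(i, s). w i ^ s)) * det (mat n n (\<lambda>(s, r). coeff (f r) s))"
proof -
  have "mat n n (\<lambda>(i, r). poly (f r) (w i)) =
     mat n n (\<lambda>(i, s). w i ^ s) * mat n n (\<lambda>(s, r). coeff (f r) s)"
  proof (rule eq_matI)
    fix i r assume "i < dim_row (mat n n (\<lambda>(i, s). w i ^ s) * mat n n (\<lambda>(s, r). coeff (f r) s))"
      "r < dim_col (mat n n (\<lambda>(i, s). w i ^ s) * mat n n (\<lambda>(s, r). coeff (f r) s))"
    then have ir: "i < n" "r < n" by auto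
    have "poly (f r) (w i) = (\<Sum>s<n. coeff (f r) s * w i ^ s)"
      unfolding poly_altdef using assms[OF ir(2)]
      by (intro sum.mono_neutral_left) (auto simp: coeff_eq_0)
    then show "mat n n (\<lambda>(i, r). poly (f r) (w i)) $$ (i, r) =
      (mat n n (\<lambda>(i, s). w i ^ s) * mat n n (\<lambda>(s, r). coeff (f r) s)) $$ (i, r)"
      using ir by (simp add: scalar_prod_def atLeast0LessThan mult.commute)
  qed auto
  then show ?thesis by (simp add: det_mult[of _ n])
qed

lemma prod_pairs_lessThan:
  fixes g :: "nat \<Rightarrow> nat \<Rightarrow> real"
  shows "(\<Prod>(i, j)\<in>pairs {..<n}. g i j) = (\<Prod>j<n. \<Prod>i<j. g i j)"
proof -
  have "(\<Prod>j<n. \<Prod>i<j. g i j) = (\<Prod>(j, i)\<in>(SIGMA j:{..<n}. {..<j}). g i j)"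
    by (subst prod.Sigma) auto
  also have "\<dots> = (\<Prod>(i, j)\<in>pairs {..<n}. g i j)"
    by (rule prod.reindex_bij_witness[of _ prod.swap prod.swap]) (auto simp: pairs_def)
  finally show ?thesis ..
qed

lemma det_vandermonde:
  fixes w :: "nat \<Rightarrow> real"
  shows "det (mat n n (\<lambda>(i, r). w i ^ r)) = (\<Prod>(i, j)\<in>pairs {..<n}. w j - w i)"
proof -
  \<comment> \<open>The Newton basis makes the evaluation matrix at the nodes triangular and the
    coefficient matrix triangular with unit diagonal.\<close>
  define f where "f r = (\<Prod>s<r. [:- w s, 1:])" for r
  have deg: "degree (f r) = r" for r
    unfolding f_def by (subst degree_prod_eq_sum_degree) auto
  have "coeff (f r) r = 1" for r
    using lead_coeff_prod[of "\<lambda>s. [:- w s, 1:]" "{..<r}"] deg[of r] by (simp add: f_def)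
  then have "det (mat n n (\<lambda>(s, r). coeff (f r) s)) = 1"
    by (subst det_eq_prod_diag[of _ n]) (auto simp: coeff_eq_0 deg)
  moreover have "det (mat n n (\<lambda>(i, r). poly (f r) (w i))) = (\<Prod>r<n. \<Prod>s<r. w r - w s)"
    by (subst det_eq_prod_diag[of _ n]) (auto simp: f_def poly_prod intro!: prod.cong)
  moreover have "det (mat n n (\<lambda>(i, r). poly (f r) (w i))) =
    det (mat n n (\<lambda>(i, s). w i ^ s)) * det (mat n n (\<lambda>(s, r). coeff (f r) s))"
    by (rule det_poly_eval) (simp add: deg)
  ultimately show ?thesis by (simp add: prod_pairs_lessThan)
qed

text \<open>Multilinearity in the rows: each choice of one summand per row leaves a Vandermonde
  determinant in the chosen values.\<close>

lemma det_add_expand: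
  fixes u w :: "nat \<Rightarrow> real"
  shows "det (mat n n (\<lambda>(i, r). u i ^ r + c i * w i ^ r)) =
    (\<Sum>S\<in>Pow {..<n}. (\<Prod>i\<in>S. c i) *
       (\<Prod>(i, j)\<in>pairs {..<n}. (if j \<in> S then w j else u j) - (if i \<in> S then w i else u i)))"
proof -
  let ?P = "{p. p permutes {0..<n}}"
  have "(\<Prod>i\<in>{0..<n}. u i ^ p i + c i * w i ^ p i) =
     (\<Sum>S\<in>Pow {..<n}. (\<Prod>i\<in>S. c i) * (\<Prod>i\<in>{0..<n}. (if i \<in> S then w i else u i) ^ p i))" for p
  proof -
    have "(\<Prod>i\<in>{0..<n}. u i ^ p i + c i * w i ^ p i) =
       (\<Sum>S\<in>Pow {..<n}. (\<Prod>i\<in>S. c i * w i ^ p i) * (\<Prod>i\<in>{..<n}-S. u i ^ p i))"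
      by (subst add.commute) (simp add: prod_add atLeast0LessThan)
    also have "\<dots> = (\<Sum>S\<in>Pow {..<n}. (\<Prod>i\<in>S. c i) * (\<Prod>i\<in>{0..<n}. (if i \<in> S then w i else u i) ^ p i))"
    proof (intro sum.cong refl)
      fix S assume S: "S \<in> Pow {..<n}"
      have "(\<Prod>i\<in>{0..<n}. (if i \<in> S then w i else u i) ^ p i) = (\<Prod>i\<in>{..<n}-S. u i ^ p i) * (\<Prod>i\<in>S. w i ^ p i)"
        using S by (subst prod.subset_diff[of S]) (auto simp: atLeast0LessThan)
      then show "(\<Prod>i\<in>S. c i * w i ^ p i) * (\<Prod>i\<in>{..<n}-S. u i ^ p i) =
        (\<Prod>i\<in>S. c i) * (\<Prod>i\<in>{0..<n}. (if i \<in> S then w i else u i) ^ p i)"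
        by (simp add: prod.distrib mult_ac)
    qed
    finally show ?thesis .
  qed
  then have "det (mat n n (\<lambda>(i, r). u i ^ r + c i * w i ^ r)) =
    (\<Sum>p\<in>?P. signof p * (\<Sum>S\<in>Pow {..<n}. (\<Prod>i\<in>S. c i) * (\<Prod>i\<in>{0..<n}. (if i \<in> S then w i else u i) ^ p i)))"
    by (subst det_def'[of _ n]) (auto simp: permutes_in_image intro!: sum.cong prod.cong arg_cong2[where f = "(*)"])
  also have "\<dots> = (\<Sum>S\<in>Pow {..<n}. (\<Prod>i\<in>S. c i) *
      (\<Sum>p\<in>?P. signof p * (\<Prod>i\<in>{0..<n}. (if i \<in> S then w i else u i) ^ p i)))"
    by (simp add: sum_distrib_left sum.swap[of _ ?P] mult_ac)
  also have "\<dots> = (\<Sum>S\<in>Pow {..<n}. (\<Prod>i\<in>S. c i) * det (mat n n (\<lambda>(i, r). (if i \<in> S then w i else u i) ^ r)))"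
    by (subst det_def'[of _ n]) (auto simp: permutes_in_image intro!: sum.cong prod.cong arg_cong2[where f = "(*)"])
  finally show ?thesis by (simp add: det_vandermonde)
qed

lemma det_scale_rows_cols:
  fixes g :: "nat \<Rightarrow> nat \<Rightarrow> real"
  shows "det (mat n n (\<lambda>(i, j). a i * b j * g i j)) = (\<Prod>i<n. a i) * (\<Prod>j<n. b j) * det (mat n n (\<lambda>(i, j). g i j))"
proof -
  have "(\<Prod>i\<in>{0..<n}. a i * b (p i) * g i (p i)) = (\<Prod>i<n. a i) * (\<Prod>j<n. b j) * (\<Prod>i\<in>{0..<n}. g i (p i))"
    if "p permutes {0..<n}" for p
    using prod.permute[OF that, of b] by (simp add: prod.distrib atLeast0LessThan o_def)
  then have "det (mat n n (\<lambda>(i, j). a i * b j * g i j)) =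
    (\<Sum>p | p permutes {0..<n}. signof p * ((\<Prod>i<n. a i) * (\<Prod>j<n. b j) * (\<Prod>i\<in>{0..<n}. g i (p i))))"
    by (subst det_def'[of _ n]) (auto simp: permutes_in_image intro!: sum.cong)
  also have "\<dots> = (\<Prod>i<n. a i) * (\<Prod>j<n. b j) * det (mat n n (\<lambda>(i, j). g i j))"
    by (subst det_def'[of _ n])
      (auto simp: permutes_in_image sum_distrib_left mult_ac intro!: sum.cong prod.cong arg_cong2[where f = "(*)"])
  finally show ?thesis .
qed

lemma tendsto_det:
  fixes A :: "nat \<Rightarrow> nat \<Rightarrow> 'a \<Rightarrow> real"
  assumes "\<And>i j. i < n \<Longrightarrow> j < n \<Longrightarrow> (A i j \<longlongrightarrow> B i j) F"
  shows "((\<lambda>e. det (mat n n (\<lambda>(i, j). A i j e))) \<longlongrightarrow> det (mat n n (\<lambda>(i, j). B i j))) F"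
proof -
  have "det (mat n n (\<lambda>(i, j). C i j)) = (\<Sum>p | p permutes {0..<n}. signof p * (\<Prod>i\<in>{0..<n}. C i (p i)))" for C :: "nat \<Rightarrow> nat \<Rightarrow> real"
    by (subst det_def'[of _ n]) (auto simp: permutes_in_image intro!: sum.cong prod.cong arg_cong2[where f = "(*)"])
  then show ?thesis
    by (auto intro!: tendsto_intros assms simp: permutes_in_image)
qed

text \<open>Multiplication by the inverse of the matrix of odd powers of \<open>1, ..., n\<close>
  isolates the coefficient of each \<open>y ^ (2*l+1)\<close>. After division by
  \<open>e ^ (2*l+1)\<close> the remainder \<open>O(e ^ (2*n))\<close> tends to 0, because
  \<open>l < n\<close>.\<close>

lemma det_confluent_limit:
  fixes g :: "nat \<Rightarrow> real \<Rightarrow> real"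
  assumes g: "\<And>r. r < n \<Longrightarrow> (\<lambda>y. g r y - (\<Sum>l<n. c l r * y ^ (2*l+1))) \<in> O[at_right 0](\<lambda>y. y ^ (2*n))"
  shows "((\<lambda>e. det (mat n n (\<lambda>(i, r). g r (e * real (i + 1)))) /
      det (mat n n (\<lambda>(i, l). (e * real (i + 1)) ^ (2*l+1)))) \<longlongrightarrow> det (mat n n (\<lambda>(l, r). c l r))) (at_right 0)"
proof -
  \<comment> \<open>The denominator matrix at \<open>e = 1\<close>. It is invertible since, after
    one factor \<open>i + 1\<close> is taken from each row, it is Vandermonde in the distinct
    squares of \<open>1, ..., n\<close>.\<close>
  define W where "W = mat n n (\<lambda>(i, l). real (i + 1) ^ (2*l+1))"
  have W: "W \<in> carrier_mat n n" by (simp add: W_def)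
  have "W = mat n n (\<lambda>(i, l). real (i + 1) * 1 * (real (i + 1) ^ 2) ^ l)"
    unfolding W_def by (intro cong_mat) (auto simp: power_mult[symmetric] power_add[symmetric] mult.commute)
  then have detW: "det W = (\<Prod>i<n. real (i + 1)) * (\<Prod>(i, j)\<in>pairs {..<n}. real (j + 1) ^ 2 - real (i + 1) ^ 2)"
    by (simp only: det_scale_rows_cols det_vandermonde) simp
  have "(real (j + 1))\<^sup>2 \<noteq> (real (i + 1))\<^sup>2" if "(i, j) \<in> pairs {..<n}" for i j
  proof -
    have "(real (i + 1))\<^sup>2 < (real (j + 1))\<^sup>2"
      using that by (intro power_strict_mono) (auto simp: pairs_def)
    then show ?thesis by (rule less_imp_neq[THEN not_sym])
  qed
  then have nz: "det W \<noteq> 0" unfolding detW by (auto simp del: of_nat_add of_nat_Suc)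
  then obtain L where L: "L \<in> carrier_mat n n" "L * W = 1\<^sub>m n"
    using det_non_zero_imp_unit[OF W nz, unfolded Units_def ring_mat_def] by auto
  have detLW: "det L * det W = 1"
    using det_mult[OF L(1) W] L(2) by simp
  have LW: "(\<Sum>i<n. L $$ (l, i) * real (i + 1) ^ (2*l'+1)) = of_bool (l = l')" if "l < n" "l' < n" for l l'
  proof -
    have "(L * W) $$ (l, l') = (\<Sum>i<n. L $$ (l, i) * real (i + 1) ^ (2*l'+1))"
      using that L(1) by (simp add: W_def scalar_prod_def atLeast0LessThan)
    then show ?thesis using L(2) that by auto
  qed
  define H where "H l r e = (\<Sum>i<n. L $$ (l, i) * g r (e * real (i + 1))) / e ^ (2*l+1)" for l r e
  have H: "(H l r \<longlongrightarrow> c l r) (at_right 0)" if lr: "l < n" "r < n" for l r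
  proof -
    define d where "d = (\<lambda>y. g r y - (\<Sum>l<n. c l r * y ^ (2*l+1)))"
    have dO: "(\<lambda>e. d (e * real (i + 1))) \<in> O[at_right 0](\<lambda>e. e ^ (2*n))" for i
    proof -
      have "filterlim (\<lambda>e::real. e * real (i + 1)) (at_right 0) (at_right 0)"
        unfolding filterlim_at by (auto intro!: tendsto_eq_intros eventually_at_right_less[THEN eventually_mono])
      from landau_o.big.compose[OF g[OF lr(2), folded d_def] this]
      have "(\<lambda>e. d (e * real (i + 1))) \<in> O[at_right 0](\<lambda>e. (e * real (i + 1)) ^ (2*n))" .
      then show ?thesis by (simp add: power_mult_distrib)
    qed
    have "(\<lambda>e. \<Sum>i<n. L $$ (l, i) * d (e * real (i + 1))) \<in> O[at_right 0](\<lambda>e. e ^ (2*n))"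
      using dO by (intro big_sum_in_bigo) simp
    also have "(\<lambda>e::real. e ^ (2*n)) \<in> o[at_right 0](\<lambda>e. e ^ (2*l+1))"
    proof (rule smalloI_tendsto)
      have "((\<lambda>e::real. e ^ (2 * (n - l) - 1)) \<longlongrightarrow> 0) (at_right 0)"
        using lr(1) by (auto intro!: tendsto_eq_intros)
      moreover have "\<forall>\<^sub>F e::real in at_right 0. e ^ (2 * (n - l) - 1) = e ^ (2*n) / e ^ (2*l+1)"
        using eventually_at_right_less[of "0::real"]
      proof eventually_elim
        case (elim e)
        have "2*n = (2 * (n - l) - 1) + (2*l+1)" using lr(1) by simp
        then have "e ^ (2*n) = e ^ (2 * (n - l) - 1) * e ^ (2*l+1)" by (metis power_add)
        then show ?case using elim by simp
      qed
      ultimately show "((\<lambda>e::real. e ^ (2*n) / e ^ (2*l+1)) \<longlongrightarrow> 0) (at_right 0)"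
        by (rule Lim_transform_eventually)
    next
      show "\<forall>\<^sub>F e::real in at_right 0. e ^ (2*l+1) \<noteq> 0"
        using eventually_at_right_less[of "0::real"] by eventually_elim simp
    qed
    finally have "((\<lambda>e. (\<Sum>i<n. L $$ (l, i) * d (e * real (i + 1))) / e ^ (2*l+1)) \<longlongrightarrow> 0) (at_right 0)"
      by (rule smalloD_tendsto)
    then have "((\<lambda>e. c l r + (\<Sum>i<n. L $$ (l, i) * d (e * real (i + 1))) / e ^ (2*l+1)) \<longlongrightarrow> c l r + 0) (at_right 0)"
      by (intro tendsto_intros)
    moreover have "\<forall>\<^sub>F e in at_right 0. c l r + (\<Sum>i<n. L $$ (l, i) * d (e * real (i + 1))) / e ^ (2*l+1) = H l r e"
      using eventually_at_right_less[of "0::real"]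
    proof eventually_elim
      case (elim e)
      have "(\<Sum>i<n. L $$ (l, i) * g r (e * real (i + 1))) =
        (\<Sum>i<n. L $$ (l, i) * d (e * real (i + 1))) + (\<Sum>i<n. L $$ (l, i) * (\<Sum>l'<n. c l' r * (e * real (i + 1)) ^ (2*l'+1)))"
        by (simp add: d_def sum.distrib[symmetric] distrib_left[symmetric])
      also have "(\<Sum>i<n. L $$ (l, i) * (\<Sum>l'<n. c l' r * (e * real (i + 1)) ^ (2*l'+1))) =
        (\<Sum>l'<n. c l' r * e ^ (2*l'+1) * (\<Sum>i<n. L $$ (l, i) * real (i + 1) ^ (2*l'+1)))"
        unfolding sum_distrib_left power_mult_distrib by (subst sum.swap) (simp only: mult_ac)
      also have "\<dots> = (\<Sum>l'<n. c l' r * e ^ (2*l'+1) * of_bool (l = l'))"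
        using LW[OF lr(1)] by (intro sum.cong) auto
      also have "\<dots> = c l r * e ^ (2*l+1)" using lr(1) by (simp add: of_bool_def if_distrib cong: if_cong)
      finally show ?case using elim by (simp add: H_def field_simps del: power_Suc)
    qed
    ultimately show ?thesis by (auto intro: Lim_transform_eventually)
  qed
  have "((\<lambda>e. det (mat n n (\<lambda>(l, r). H l r e))) \<longlongrightarrow> det (mat n n (\<lambda>(l, r). c l r))) (at_right 0)"
    by (intro tendsto_det H)
  moreover have "\<forall>\<^sub>F e in at_right 0. det (mat n n (\<lambda>(l, r). H l r e)) =
    det (mat n n (\<lambda>(i, r). g r (e * real (i + 1)))) / det (mat n n (\<lambda>(i, l). (e * real (i + 1)) ^ (2*l+1)))"
    using eventually_at_right_less[of "0::real"]
  proof eventually_elim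
    case (elim e)
    let ?G = "mat n n (\<lambda>(i, r). g r (e * real (i + 1)))" and ?P = "\<Prod>l<n. e ^ (2*l+1)"
    have "L * ?G = mat n n (\<lambda>(l, r). e ^ (2*l+1) * 1 * H l r e)"
      using L(1) elim by (intro eq_matI) (auto simp: H_def scalar_prod_def atLeast0LessThan)
    then have "det L * det ?G = ?P * det (mat n n (\<lambda>(l, r). H l r e))"
      using det_mult[OF L(1), of ?G] by (simp only: det_scale_rows_cols) simp
    moreover have "mat n n (\<lambda>(i, l). (e * real (i + 1)) ^ (2*l+1)) =
      mat n n (\<lambda>(i, l). 1 * e ^ (2*l+1) * real (i + 1) ^ (2*l+1))"
      by (intro cong_mat) (auto simp: power_mult_distrib)
    then have "det (mat n n (\<lambda>(i, l). (e * real (i + 1)) ^ (2*l+1))) = ?P * det W"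
      unfolding W_def by (simp only: det_scale_rows_cols) simp
    moreover have "?P \<noteq> 0" using elim by simp
    moreover have "det L = 1 / det W" using detLW nz by (simp add: field_simps)
    ultimately show ?case using nz by (simp add: field_simps)
  qed
  ultimately show ?thesis by (rule Lim_transform_eventually)
qed

section \<open>A bounded Littlewood identity\<close>

text \<open>Differences of nodes are unchanged by a common shift, so \<open>a\<close> is free. The
  value 0 serves to show vanishing; the value 1 turns \<open>1 + v\<close> and \<open>1 + w\<close>
  into \<open>v\<close> and \<open>w\<close>.\<close>

lemma subset_sum_det:
  assumes "\<forall>i<n. 0 < x i \<and> x i < 1" "inj_on x {..<n}"
  shows "subset_sum x e {..<n} * (\<Prod>(i, j)\<in>pairs {..<n}. node_val (x j) - node_val (x i)) =
    det (mat n n (\<lambda>(i, r). (node_val (x i) - a) ^ r - x i powi e * (x i * node_val (x i) - a) ^ r))"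
proof -
  have inj: "inj_on (\<lambda>i. node_val (x i)) {..<n}"
    by (rule inj_on_node_val) (use assms in auto)
  then have nz: "node_val (x j) \<noteq> node_val (x i)" if "(i, j) \<in> pairs {..<n}" for i j
    using that by (auto simp: pairs_def inj_on_def)
  have "(\<Prod>(i, j)\<in>pairs {..<n}. (swap_val x S j - swap_val x S i) / (node_val (x j) - node_val (x i))) *
       (\<Prod>(i, j)\<in>pairs {..<n}. node_val (x j) - node_val (x i)) =
    (\<Prod>(i, j)\<in>pairs {..<n}. (if j \<in> S then x j * node_val (x j) - a else node_val (x j) - a) -
       (if i \<in> S then x i * node_val (x i) - a else node_val (x i) - a))" for S
    unfolding prod.distrib[symmetric]
    by (intro prod.cong refl) (auto simp: swap_val_def nz)
  then show ?thesis
    using det_add_expand[of n "\<lambda>i. node_val (x i) - a" "\<lambda>i. - (x i powi e)" "\<lambda>i. x i * node_val (x i) - a"]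
    by (simp add: subset_sum_def sum_distrib_right mult.assoc)
qed

text \<open>An increasing enumeration preserves the ordered pairs; it carries the determinant
  formula over to any finite index set.\<close>

lemma subset_sum_reindex:
  assumes "strict_mono_on {..<n} en" "en ` {..<n} = I"
  shows "subset_sum x e I = subset_sum (x \<circ> en) e {..<n}"
proof -
  have inj: "inj_on en {..<n}" using assms(1) by (rule strict_mono_on_imp_inj_on)
  have sub: "S \<subseteq> {..<n} \<Longrightarrow> inj_on en S" for S using inj by (rule inj_on_subset)
  have pr: "pairs I = map_prod en en ` pairs {..<n}"
    using assms by (fastforce simp: pairs_def image_iff strict_mono_on_less)
  have injp: "inj_on (map_prod en en) (pairs {..<n})"
    using map_prod_inj_on[OF inj inj] by (rule inj_on_subset) (auto simp: pairs_def)
  have memb: "en i \<in> en ` S \<longleftrightarrow> i \<in> S" if "i < n" "S \<subseteq> {..<n}" for i S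
    using inj_on_image_mem_iff[OF inj] that by simp
  have "subset_sum x e I = (\<Sum>S\<in>Pow {..<n}. (\<Prod>i\<in>en ` S. - (x i powi e)) *
      (\<Prod>(i, j)\<in>map_prod en en ` pairs {..<n}. (swap_val x (en ` S) j - swap_val x (en ` S) i) / (node_val (x j) - node_val (x i))))"
    unfolding subset_sum_def assms(2)[symmetric] pr[folded assms(2)] image_Pow_surj[OF refl, symmetric]
    by (subst sum.reindex) (use inj in \<open>auto intro!: inj_on_image_Pow\<close>)
  also have "\<dots> = subset_sum (x \<circ> en) e {..<n}"
    unfolding subset_sum_def
  proof (intro sum.cong refl arg_cong2[where f = "(*)"])
    fix S assume S: "S \<in> Pow {..<n}"
    show "(\<Prod>i\<in>en ` S. - (x i powi e)) = (\<Prod>i\<in>S. - ((x \<circ> en) i powi e))"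
      using S sub by (subst prod.reindex) auto
    show "(\<Prod>(i, j)\<in>map_prod en en ` pairs {..<n}. (swap_val x (en ` S) j - swap_val x (en ` S) i) / (node_val (x j) - node_val (x i))) =
      (\<Prod>(i, j)\<in>pairs {..<n}. (swap_val (x \<circ> en) S j - swap_val (x \<circ> en) S i) / (node_val ((x \<circ> en) j) - node_val ((x \<circ> en) i)))"
      using S by (subst prod.reindex[OF injp]) (auto simp: swap_val_def pairs_def memb intro!: prod.cong)
  qed
  finally show ?thesis .
qed

lemma subset_sum_eq_0:
  assumes "finite I" "I \<noteq> {}" "\<forall>i\<in>I. 0 < x i \<and> x i < 1" "inj_on x I"
  shows "subset_sum x (1 - int (card I)) I = 0"
proof -
  define n where "n = card I"
  define en where "en = (\<lambda>i. sorted_list_of_set I ! i)"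
  have n: "n > 0" using assms by (simp add: n_def card_gt_0_iff)
  have mono: "strict_mono_on {..<n} en"
    using assms(1) by (intro strict_mono_onI) (simp add: en_def n_def sorted_wrt_nth_less[OF strict_sorted_list_of_set])
  have im: "en ` {..<n} = I"
  proof -
    have "en ` {..<n} = set (sorted_list_of_set I)"
      by (auto simp: en_def n_def set_conv_nth simp del: set_sorted_list_of_set)
    then show ?thesis using assms(1) by simp
  qed
  have x: "\<forall>i<n. 0 < (x \<circ> en) i \<and> (x \<circ> en) i < 1" "inj_on (x \<circ> en) {..<n}"
    using assms(3,4) im strict_mono_on_imp_inj_on[OF mono] by (auto intro!: comp_inj_on)
  let ?A = "mat n n (\<lambda>(i, r). (node_val ((x \<circ> en) i) - 0) ^ r - (x \<circ> en) i powi (1 - int n) * ((x \<circ> en) i * node_val ((x \<circ> en) i) - 0) ^ r)"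
  \<comment> \<open>With exponent \<open>1 - n\<close> the two summands agree in the last column,
    \<open>r = n - 1\<close>.\<close>
  have "det ?A = 0"
  proof -
    have "y powi (1 - int n) * (y * z) ^ (n - 1) = z ^ (n - 1)" if "y > 0" for y z :: real
    proof -
      have "y powi (1 - int n) * y ^ (n - 1) = y powi (1 - int n + int (n - 1))"
        using that by (simp add: power_int_add)
      then show ?thesis using n by (simp add: power_mult_distrib flip: mult.assoc)
    qed
    then have "\<forall>i<n. ?A $$ (i, n - 1) = 0" using x(1) n by auto
    then show ?thesis using n by (subst laplace_expansion_column[of _ n "n - 1"]) auto
  qed
  moreover have "subset_sum (x \<circ> en) (1 - int n) {..<n} * (\<Prod>(i, j)\<in>pairs {..<n}. node_val ((x \<circ> en) j) - node_val ((x \<circ> en) i)) = det ?A"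
    by (rule subset_sum_det[OF x])
  moreover have "(\<Prod>(i, j)\<in>pairs {..<n}. node_val ((x \<circ> en) j) - node_val ((x \<circ> en) i)) \<noteq> 0"
  proof -
    have "inj_on (\<lambda>i. node_val ((x \<circ> en) i)) {..<n}"
      using x(1) by (intro inj_on_node_val[OF x(2)]) auto
    then have "node_val ((x \<circ> en) j) \<noteq> node_val ((x \<circ> en) i)" if "(i, j) \<in> pairs {..<n}" for i j
      using that unfolding pairs_def inj_on_def by fastforce
    then show ?thesis by auto
  qed
  ultimately show ?thesis using subset_sum_reindex[OF mono im] by (simp add: n_def)
qed

text \<open>Both sides satisfy the same recursion in \<open>N\<close> and agree at
  \<open>N = 0\<close>. The exponent depends on \<open>card I\<close> so that removing one index
  raises it by one, as \<open>subset_sum_rec\<close> demands.\<close>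

theorem strict_sum_eq:
  assumes "finite I" "\<forall>i\<in>I. 0 < x i \<and> x i < 1" "inj_on x I"
  shows "strict_sum x N I = subset_factor x I * subset_sum x (int N - int (card I) + 1) I"
  using assms
proof (induction N arbitrary: I)
  case 0
  then show ?case
    using subset_sum_eq_0[of I x] by (cases "I = {}") (auto simp: strict_sum_0 subset_factor_def subset_sum_def)
next
  case (Suc N)
  show ?case
  proof (cases "I = {}")
    case False
    have IH: "strict_sum x N (I - {i}) = subset_factor x (I - {i}) * subset_sum x (int N - int (card I) + 1 + 1) (I - {i})" if "i \<in> I" for i
    proof -
      have "int (card I) = int (card (I - {i})) + 1" using card.remove[OF Suc.prems(1) that] by simp
      then show ?thesis
        using Suc.IH[of "I - {i}"] Suc.prems by (auto simp: inj_on_diff)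
    qed
    have "\<forall>i\<in>I. x i \<noteq> 0" using Suc.prems(2) by auto
    then have "strict_sum x (Suc N) I = subset_factor x I * subset_sum x (int N - int (card I) + 1 + 1) I"
      using subset_sum_rec[OF Suc.prems, of "int N - int (card I) + 1"]
        strict_sum_Suc[OF Suc.prems(1) False, of x N] IH Suc.IH[OF Suc.prems]
      by simp
    then show ?thesis by (simp add: algebra_simps)
  qed (simp add: subset_factor_def subset_sum_def)
qed

section \<open>The determinant of ballot numbers\<close>

text \<open>The coefficient of \<open>y ^ m\<close> in the \<open>j\<close>-th power of the Catalan
  series \<open>C = 1 + y * C\<^sup>2\<close>. The power 0 is separate, since the quotient would
  give 0 instead of 1 at \<open>m = 0\<close>.\<close>

definition ballot :: "nat \<Rightarrow> nat \<Rightarrow> real" where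
  "ballot j m = (if j = 0 then of_bool (m = 0) else j * fact (j + 2 * m - 1) / (fact m * fact (j + m)))"

lemma ballot_0: "ballot j 0 = 1"
  by (cases j) (simp_all add: ballot_def del: of_nat_Suc)

text \<open>The coefficient form of \<open>C ^ (j+1) = C ^ j + y * C ^ (j+2)\<close>.\<close>

lemma ballot_rec: "ballot (Suc j) (Suc m) = ballot j (Suc m) + ballot (Suc (Suc j)) m"
proof (cases j)
  case 0
  have "fact (2 * m + 2) = (2 * real m + 2) * fact (2 * m + 1)"
    by (simp add: fact_Suc algebra_simps del: of_nat_add)
  then show ?thesis
    by (simp add: ballot_def 0 fact_Suc divide_simps numeral_2_eq_2 del: of_nat_Suc) (simp add: algebra_simps)
next
  case (Suc i)
  have [simp]: "i + 2 * m + 2 = Suc (Suc (i + 2 * m))" "i + 2 * m + 3 = Suc (Suc (Suc (i + 2 * m)))" by simp_all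
  show ?thesis
    by (simp add: ballot_def Suc fact_Suc divide_simps del: of_nat_Suc) (simp add: algebra_simps)
qed

text \<open>The coefficient of \<open>y ^ (2*l+1)\<close> in \<open>y ^ r * C ^ (M + 2*r)\<close>,
  which is \<open>v ^ r * (1 + v) ^ M\<close> because
  \<open>v = C - 1 = y * C\<^sup>2\<close>.\<close>

definition ballot_entry :: "nat \<Rightarrow> nat \<Rightarrow> nat \<Rightarrow> real" where
  "ballot_entry M l r = (if r \<le> 2 * l + 1 then ballot (M + 2 * r) (2 * l + 1 - r) else 0)"

definition ballot_poly :: "nat \<Rightarrow> nat \<Rightarrow> nat \<Rightarrow> real poly" where
  "ballot_poly M n r = (\<Prod>i<r. [:- real i, 1:]) * (\<Prod>i\<in>{r<..<n}. [:real (M + i), 1:])"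

lemma prod_diff_fact: "r \<le> X \<Longrightarrow> (\<Prod>i<r. real X - real i) = fact X / fact (X - r)"
proof (induction r)
  case (Suc r)
  have "X - r = Suc (X - Suc r)" using Suc.prems by simp
  then have "fact (X - r) = (real X - real r) * fact (X - Suc r)"
    using Suc.prems by (simp add: of_nat_diff)
  moreover have "real X - real r \<noteq> 0" using Suc.prems by simp
  ultimately show ?case using Suc by simp
qed simp

lemma prod_add_fact: "r < n \<Longrightarrow> (\<Prod>i\<in>{r<..<n}. real (Y + i)) = fact (Y + n - 1) / fact (Y + r)"
proof (induction n)
  case (Suc n)
  show ?case
  proof (cases "r = n")
    case True
    then have "{r<..<Suc n} = {}" by auto
    then show ?thesis using True by simp
  next
    case False
    then have "{r<..<Suc n} = insert n {r<..<n}" using Suc.prems by auto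
    moreover have "fact (Y + n) = real (Y + n) * fact (Y + n - 1)"
      using False Suc.prems by (simp add: fact_reduce)
    ultimately show ?thesis using Suc False by simp
  qed
qed simp

text \<open>Both factorials in the denominator that involve \<open>r\<close> are extended to
  factorials free of \<open>r\<close>; what this costs is the two products in
  \<open>ballot_poly\<close>. For \<open>r > 2*l+1\<close> the falling factorial vanishes, in
  accordance with the default 0.\<close>

lemma ballot_entry_eq:
  assumes "M \<ge> 1" "r < n"
  shows "ballot_entry M l r = (fact (M + 4 * l + 1) / (fact (2 * l + 1) * fact (M + 2 * l + n))) *
     real (M + 2 * r) * poly (ballot_poly M n r) (real (2 * l + 1))"
proof -
  let ?X = "2 * l + 1"
  have p: "poly (ballot_poly M n r) (real ?X) = (\<Prod>i<r. real ?X - real i) * (\<Prod>i\<in>{r<..<n}. real (M + ?X + i))"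
    by (simp add: ballot_poly_def poly_prod algebra_simps)
  show ?thesis
  proof (cases "r \<le> ?X")
    case True
    have e: "M + 2 * r + 2 * (?X - r) - 1 = M + 4 * l + 1" "M + 2 * r + (?X - r) = M + ?X + r" using True assms by auto
    have "M + ?X + n - 1 = M + 2 * l + n" by simp
    then have "poly (ballot_poly M n r) (real ?X) = fact ?X / fact (?X - r) * (fact (M + 2 * l + n) / fact (M + ?X + r))"
      unfolding p prod_diff_fact[OF True] prod_add_fact[OF assms(2)] by simp
    moreover have "ballot_entry M l r = real (M + 2 * r) * fact (M + 4 * l + 1) / (fact (?X - r) * fact (M + ?X + r))"
      using True assms unfolding ballot_entry_def ballot_def e by simp
    ultimately show ?thesis by (simp del: fact_Suc)
  next
    case False
    then have "(\<Prod>i<r. real ?X - real i) = 0"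
      by (intro prod_zero) (auto intro!: bexI[of _ ?X])
    then show ?thesis using False unfolding p by (simp add: ballot_entry_def)
  qed
qed

lemma degree_ballot_poly: "r < n \<Longrightarrow> degree (ballot_poly M n r) < n"
  unfolding ballot_poly_def
  by (subst degree_mult_eq) (auto simp: degree_prod_eq_sum_degree)

text \<open>The constant \<open>?K\<close> is the same for all nodes. At the nodes
  \<open>0, ..., n - 1\<close> the matrix is triangular, as the column for \<open>r\<close> vanishes
  below \<open>r\<close>; this gives \<open>?K\<close>, and the odd nodes only double the
  differences.\<close>

lemma det_ballot_poly:
  "det (mat n n (\<lambda>(l, r). poly (ballot_poly M n r) (real (2 * l + 1)))) =
     (\<Prod>j<n. 2 ^ j * fact j * (\<Prod>i<j. real (M + i + j)))"
proof -
  let ?D = "\<lambda>w. det (mat n n (\<lambda>(l, r). poly (ballot_poly M n r) (w l)))"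
  let ?K = "det (mat n n (\<lambda>(s, r). coeff (ballot_poly M n r) s))"
  have D: "?D w = (\<Prod>j<n. \<Prod>i<j. w j - w i) * ?K" for w
    by (subst det_poly_eval) (simp_all add: degree_ballot_poly det_vandermonde prod_pairs_lessThan)
  have fct: "(\<Prod>i<j. real j - real i) = fact j" for j
    using prod_diff_fact[of j j] by simp
  have "?D real = (\<Prod>r<n. poly (ballot_poly M n r) (real r))"
    by (subst det_eq_prod_diag[of _ n]) (auto simp: ballot_poly_def poly_prod)
  also have "\<dots> = (\<Prod>r<n. fact r * (\<Prod>i\<in>{r<..<n}. real (M + r + i)))"
    by (intro prod.cong refl) (simp add: ballot_poly_def poly_prod fct algebra_simps)
  also have "\<dots> = (\<Prod>j<n. fact j) * (\<Prod>j<n. \<Prod>i<j. real (M + i + j))"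
  proof -
    have "(\<Prod>r<n. \<Prod>i\<in>{r<..<n}. real (M + r + i)) = (\<Prod>(r, i)\<in>pairs {..<n}. real (M + r + i))"
      by (subst prod.Sigma) (auto intro!: prod.cong simp: pairs_def)
    then show ?thesis by (simp add: prod.distrib prod_pairs_lessThan)
  qed
  finally have "(\<Prod>j<n. fact j) * ?K = (\<Prod>j<n. fact j) * (\<Prod>j<n. \<Prod>i<j. real (M + i + j))"
    unfolding D by (simp add: fct)
  then have K: "?K = (\<Prod>j<n. \<Prod>i<j. real (M + i + j))" by simp
  have "(\<Prod>i<j. real (2 * j + 1) - real (2 * i + 1)) = 2 ^ j * fact j" for j
  proof -
    have "(\<Prod>i<j. real (2 * j + 1) - real (2 * i + 1)) = (\<Prod>i<j. 2 * (real j - real i))"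
      by (intro prod.cong) auto
    then show ?thesis by (simp only: prod.distrib fct prod_constant card_lessThan)
  qed
  then show ?thesis unfolding D K by (simp add: prod.distrib)
qed

definition ballot_det :: "nat \<Rightarrow> nat \<Rightarrow> real" where
  "ballot_det M n = det (mat n n (\<lambda>(l, r). ballot_entry M l r))"

lemma ballot_det_prod:
  assumes "M \<ge> 1"
  shows "ballot_det M n = (\<Prod>l<n. fact (M + 4 * l + 1) / (fact (2 * l + 1) * fact (M + 2 * l + n))) *
     (\<Prod>r<n. real (M + 2 * r)) * (\<Prod>j<n. 2 ^ j * fact j * (\<Prod>i<j. real (M + i + j)))"
proof -
  have "mat n n (\<lambda>(l, r). ballot_entry M l r) =
    mat n n (\<lambda>(l, r). (fact (M + 4 * l + 1) / (fact (2 * l + 1) * fact (M + 2 * l + n))) *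
     real (M + 2 * r) * poly (ballot_poly M n r) (real (2 * l + 1)))"
    using ballot_entry_eq[OF assms] by (intro cong_mat) auto
  then show ?thesis
    unfolding ballot_det_def
    by (simp only: det_scale_rows_cols det_ballot_poly)
qed

text \<open>Raising \<open>n\<close> divides each old row factor by \<open>M + 2*l + n + 1\<close>.
  These divisors form the Pochhammer symbol with half-integral step; the new row, column and
  Vandermonde factors supply the other three.\<close>

lemma ballot_det_Suc:
  assumes "M \<ge> 1"
  shows "ballot_det M (Suc n) = ballot_det M n *
    (pochhammer (real (M + 3 * n + 2)) n * pochhammer (real (M + n)) (Suc n) /
      (pochhammer (real (M + n + 1) / 2) n * pochhammer (real (n + 1)) (Suc n)))"
proof -
  have poch: "pochhammer (real (a + 1)) k = fact (a + k) / fact a" for a k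
    using pochhammer_product'[of "1::real" a k] by (simp add: pochhammer_fact[symmetric] add.commute field_simps)
  have 1: "pochhammer (real (M + 3 * n + 2)) n = fact (M + 4 * n + 1) / fact (M + 3 * n + 1)"
    using poch[of "M + 3 * n + 1" n] by (simp add: algebra_simps del: fact_Suc)
  have 2: "pochhammer (real (M + n)) (Suc n) = (\<Prod>i<n. real (M + i + n)) * real (M + 2 * n)"
    by (simp add: pochhammer_prod atLeast0LessThan algebra_simps)
  have 3: "pochhammer (real (M + n + 1) / 2) n = (\<Prod>l<n. real (M + 2 * l + Suc n)) / 2 ^ n"
  proof -
    have "(\<Prod>l<n. real (M + 2 * l + Suc n)) / 2 ^ n = (\<Prod>l<n. real (M + 2 * l + Suc n) / 2)"
      by (simp only: prod_dividef prod_constant card_lessThan)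
    also have "\<dots> = pochhammer (real (M + n + 1) / 2) n"
      unfolding pochhammer_prod atLeast0LessThan by (intro prod.cong refl) (simp add: field_simps)
    finally show ?thesis ..
  qed
  have 4: "pochhammer (real (n + 1)) (Suc n) = fact (2 * n + 1) / fact n"
    using poch[of n "Suc n"] by (simp add: mult_2 add.commute del: fact_Suc)
  define F where "F k l = (fact (M + 4 * l + 1) / (fact (2 * l + 1) * fact (M + 2 * l + k)) :: real)" for k l
  have "F (Suc n) l = F n l / real (M + 2 * l + Suc n)" for l
  proof -
    have "fact (M + 2 * l + Suc n) = real (M + 2 * l + Suc n) * fact (M + 2 * l + n)" by simp
    then show ?thesis by (simp only: F_def mult_ac divide_divide_eq_left)
  qed
  then have 5: "(\<Prod>l<n. F (Suc n) l) = (\<Prod>l<n. F n l) / (\<Prod>l<n. real (M + 2 * l + Suc n))"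
    by (simp only: prod_dividef)
  have "M + 2 * n + Suc n = M + 3 * n + 1" by simp
  then have 6: "F (Suc n) n = fact (M + 4 * n + 1) / (fact (2 * n + 1) * fact (M + 3 * n + 1))"
    by (simp only: F_def)
  show ?thesis
    unfolding ballot_det_prod[OF assms] 1 2 3 4 F_def[symmetric] prod.lessThan_Suc 5 6
    by (simp add: mult_ac del: fact_Suc of_nat_add of_nat_Suc)
qed

lemma ballot_det_eq:
  assumes "M \<ge> 1"
  shows "ballot_det M n = (\<Prod>i=1..n. pochhammer (real M + 3 * real i - 1) (i - 1) * pochhammer (real M + real i - 1) i
     / (pochhammer ((real M + real i) / 2) (i - 1) * pochhammer (real i) i))"
proof (induction n)
  case (Suc n)
  then show ?case using ballot_det_Suc[OF assms, of n] by (simp add: algebra_simps)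
qed (simp add: ballot_det_def)

section \<open>The limit\<close>

text \<open>The reciprocal of \<open>1 + v\<close> as a function of \<open>y\<close>.\<close>

definition half_root :: "real \<Rightarrow> real" where "half_root y = (1 + sqrt (1 - 4 * y)) / 2"

lemma half_root_props:
  assumes "\<bar>y\<bar> < 1/4"
  shows "half_root y > 0" "half_root y * (1 - half_root y) = y" "1 / half_root y = 1 + y * (1 / half_root y)\<^sup>2"
proof -
  have s: "sqrt (1 - 4 * y) \<ge> 0" "(sqrt (1 - 4 * y))\<^sup>2 = 1 - 4 * y" using assms by auto
  show 1: "half_root y > 0" using s(1) by (simp add: half_root_def add_pos_nonneg)
  show 2: "half_root y * (1 - half_root y) = y" using s(2) by (simp add: half_root_def field_simps power2_eq_square)
  show "1 / half_root y = 1 + y * (1 / half_root y)\<^sup>2"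
  proof -
    have "y * (1 / half_root y)\<^sup>2 = half_root y * (1 - half_root y) * (1 / half_root y)\<^sup>2" by (simp only: 2)
    then show ?thesis using 1 by (simp add: field_simps power2_eq_square)
  qed
qed

lemma tendsto_half_root: "(f \<longlongrightarrow> 0) F \<Longrightarrow> ((\<lambda>e. half_root (f e)) \<longlongrightarrow> 1) F"
  unfolding half_root_def by (auto intro!: tendsto_eq_intros)

text \<open>Here \<open>1 / half_root y\<close> is the Catalan function. Its relation
  \<open>C ^ (j+1) = C ^ j + y * C ^ (j+2)\<close> gains one order in \<open>y\<close> in the last
  term, so an outer induction on \<open>K\<close> for all \<open>j\<close> and an inner one on
  \<open>j\<close> suffice.\<close>

lemma inverse_half_root_expansion:
  "(\<lambda>y. (1 / half_root y) ^ j - (\<Sum>m<K. ballot j m * y ^ m)) \<in> O[at 0](\<lambda>y. y ^ K)"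
proof (induction K arbitrary: j)
  case 0
  have "((\<lambda>y. (1 / half_root y) ^ j) \<longlongrightarrow> 1) (at 0)"
    by (auto intro!: tendsto_eq_intros tendsto_half_root)
  then have "(\<lambda>y. (1 / half_root y) ^ j) \<in> O[at 0](\<lambda>_. 1)"
    by (intro bigoI_tendsto[where c = 1]) auto
  then show ?case by simp
next
  case (Suc K)
  note IH = Suc.IH
  show ?case
  proof (induction j)
    case 0
    have "(\<Sum>m<Suc K. ballot 0 m * y ^ m) = 1" for y
      by (subst sum.lessThan_Suc_shift) (simp add: ballot_def)
    then show ?case by simp
  next
    case (Suc j)
    have "(\<lambda>y. ((1 / half_root y) ^ j - (\<Sum>m<Suc K. ballot j m * y ^ m)) +
        y * ((1 / half_root y) ^ (j + 2) - (\<Sum>m<K. ballot (j + 2) m * y ^ m))) \<in> O[at 0](\<lambda>y. y ^ Suc K)"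
      using Suc.IH landau_o.big.mult[OF landau_o.big_refl IH[of "j + 2"], of "\<lambda>y. y"]
      unfolding power_Suc by (rule sum_in_bigo(1))
    moreover have "\<forall>\<^sub>F y in at 0. ((1 / half_root y) ^ j - (\<Sum>m<Suc K. ballot j m * y ^ m)) +
        y * ((1 / half_root y) ^ (j + 2) - (\<Sum>m<K. ballot (j + 2) m * y ^ m)) =
        (1 / half_root y) ^ Suc j - (\<Sum>m<Suc K. ballot (Suc j) m * y ^ m)"
    proof -
      have "\<forall>\<^sub>F y::real in at 0. \<bar>y\<bar> < 1/4"
        using eventually_at_in_open'[of "{-1/4<..<1/4}" "0::real"]
        by (auto elim!: eventually_mono)
      then show ?thesis
      proof eventually_elim
        case (elim y)
        have A: "(1 / half_root y) ^ Suc j = (1 / half_root y) ^ j + y * (1 / half_root y) ^ (j + 2)"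
          by (subst power_Suc, subst half_root_props(3)[OF elim]) (simp add: algebra_simps power_add power2_eq_square)
        have B: "(\<Sum>m<Suc K. ballot (Suc j) m * y ^ m) = (\<Sum>m<Suc K. ballot j m * y ^ m) + y * (\<Sum>m<K. ballot (j + 2) m * y ^ m)"
          unfolding sum.lessThan_Suc_shift
          by (simp add: ballot_rec ballot_0 sum_distrib_left sum.distrib algebra_simps)
        show ?case unfolding A B by (simp only: algebra_simps)
      qed
    qed
    ultimately show ?case by (rule landau_o.big.in_cong[THEN iffD1, rotated])
  qed
qed

section \<open>Continuity at equal variables and the parametrization by \<open>y\<close>\<close>

lemma tendsto_row_from:
  assumes "(z \<longlongrightarrow> z0) F" "z0 \<noteq> 0" "\<And>ls. ((\<lambda>e. f e ls) \<longlongrightarrow> f0 ls) F"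
  shows "((\<lambda>e. row_from (z e) c ks (f e)) \<longlongrightarrow> row_from z0 c ks f0) F"
  using assms(3)
proof (induction ks arbitrary: c f f0)
  case (Cons k ks)
  show ?case
    unfolding row_from.simps esum_def
    by (intro tendsto_intros Cons.IH Cons.prems assms)
qed simp

lemma tendsto_row_step:
  assumes "(z \<longlongrightarrow> z0) F" "z0 \<noteq> 0" "\<And>ls. ((\<lambda>e. f e ls) \<longlongrightarrow> f0 ls) F"
  shows "((\<lambda>e. row_step (z e) ks (f e)) \<longlongrightarrow> row_step z0 ks f0) F"
  by (cases ks) (simp_all, intro tendsto_intros tendsto_row_from assms)

text \<open>The formula through \<open>sym_gf\<close> needs distinct variables, but
  \<open>agt_gf\<close> itself is built from integer powers without denominators
  \<open>x j - x i\<close>, hence is continuous where all variables are 1.\<close>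

lemma tendsto_agt_gf:
  assumes "\<And>i. ((\<lambda>e. x e i) \<longlongrightarrow> 1) F"
  shows "((\<lambda>e. agt_gf (map (x e) js) ks) \<longlongrightarrow> agt_gf (replicate (length js) 1) ks) F"
proof (induction js arbitrary: ks)
  case (Cons i js)
  show ?case by (simp, rule tendsto_row_step[OF assms _ Cons.IH]) simp
qed simp

text \<open>The variable \<open>x = (1 + w) / (1 + v)\<close> as a function of \<open>y\<close>,
  where \<open>1 + v = 1 / half_root y\<close> and \<open>w\<close> arises by
  \<open>y \<mapsto> -y\<close>.\<close>

definition node :: "real \<Rightarrow> real" where "node y = half_root y / half_root (-y)"

lemma node_props:
  assumes "0 < y" "y < 1/4"
  shows "0 < node y" "node y < 1" "node_val (node y) = 1 / half_root y" "node y * node_val (node y) = 1 / half_root (-y)"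
    "y / (1 - node y) = half_root (-y) * (sqrt (1 + 4 * y) + sqrt (1 - 4 * y)) / 4"
proof -
  let ?a = "half_root y" and ?b = "half_root (-y)"
  have a: "?a > 0" "?a * (1 - ?a) = y" and b: "?b > 0" "?b * (1 - ?b) = - y"
    using half_root_props[of y] half_root_props[of "-y"] assms by auto
  \<comment> \<open>The sum of the two quadratic equations, in which \<open>y\<close>
    cancels.\<close>
  have ab: "?a\<^sup>2 + ?b\<^sup>2 = ?a + ?b" using a b by (simp add: power2_eq_square algebra_simps)
  have lt: "?a < ?b" using assms by (simp add: half_root_def)
  show "0 < node y" "node y < 1" using a b lt by (simp_all add: node_def)
  have "node_val (node y) = (?a\<^sup>2 + ?b\<^sup>2) / (?a * (?a + ?b))"
    using a(1) b(1) by (simp add: node_val_def node_def divide_simps power2_eq_square) (simp add: algebra_simps)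
  also have "\<dots> = 1 / ?a" unfolding ab using a(1) b(1) by simp
  finally show p: "node_val (node y) = 1 / half_root y" .
  show "node y * node_val (node y) = 1 / half_root (-y)" unfolding p using a(1) by (simp add: node_def)
  have "sqrt (1 + 4 * y) * sqrt (1 + 4 * y) = 1 + 4 * y" "sqrt (1 - 4 * y) * sqrt (1 - 4 * y) = 1 - 4 * y" using assms by auto
  \<comment> \<open>Multiplying by the conjugate removes the singularity of
    \<open>y / (1 - node y)\<close> at 0.\<close>
  then have "(?b - ?a) * (sqrt (1 + 4 * y) + sqrt (1 - 4 * y)) = 4 * y"
    by (simp add: half_root_def field_simps)
  moreover have "1 - node y = (?b - ?a) / ?b" using b(1) by (simp add: node_def field_simps)
  moreover from calculation(1) have "sqrt (1 + 4 * y) + sqrt (1 - 4 * y) = 4 * y / (?b - ?a)"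
    using lt by (simp add: field_simps)
  moreover have "y / (d / b) = b * (4 * y / d) / 4" for d b :: real by simp
  ultimately show "y / (1 - node y) = half_root (-y) * (sqrt (1 + 4 * y) + sqrt (1 - 4 * y)) / 4"
    by (simp only:)
qed

text \<open>A form of \<open>pair_kernel\<close> times the difference quotient below that is continuous at \<open>x = z = 1\<close>.\<close>

definition pair_reg :: "real \<Rightarrow> real \<Rightarrow> real" where
  "pair_reg x z = (node_val x + node_val z - node_val x * node_val z) / ((node_val x)\<^sup>2 * (node_val z)\<^sup>2) *
     ((1 + x + z - x * z) * pair_wt z x / (z * (1 + z) * (1 + x))) *
     ((node_val z + x * node_val x - node_val z * (x * node_val x)) / ((node_val z)\<^sup>2 * (x * node_val x)\<^sup>2))"

text \<open>Of the factors of \<open>w\<^sup>2 - y\<^sup>2\<close>, \<open>w - y\<close> cancels the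
  difference of node values, and \<open>w + y\<close> cancels the pole \<open>1 - x * z\<close> of
  the kernel. The latter works because \<open>y \<mapsto> -y\<close> inverts \<open>x\<close>, so
  \<open>w + y\<close> is divisible by \<open>r - q\<close>, which contains
  \<open>1 - z * x\<close>.\<close>

lemma pair_kernel_eq_pair_reg:
  assumes "0 < y" "y < 1/4" "0 < w" "w < 1/4" "y \<noteq> w"
  shows "node_val (node w) \<noteq> node_val (node y)"
    "pair_kernel (node y) (node w) * ((w\<^sup>2 - y\<^sup>2) / (node_val (node w) - node_val (node y))) = pair_reg (node y) (node w)"
proof -
  define x z p q r where "x = node y" and "z = node w" and "p = 1 / half_root y" and "q = 1 / half_root (-y)" and "r = 1 / half_root w"
  have x: "0 < x" "x < 1" "node_val x = p" "x * node_val x = q" and z: "0 < z" "z < 1" "node_val z = r"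
    using node_props[of y] node_props[of w] assms by (simp_all add: x_def z_def p_def q_def r_def)
  have pos: "p > 0" "q > 0" "r > 0" using half_root_props(1)[of y] half_root_props(1)[of "-y"] half_root_props(1)[of w] assms
    by (simp_all add: p_def q_def r_def)
  have y1: "y = (p - 1) / p\<^sup>2" "- y = (q - 1) / q\<^sup>2" and w1: "w = (r - 1) / r\<^sup>2"
    using half_root_props(3)[of y] half_root_props(3)[of "-y"] half_root_props(3)[of w] assms pos
    unfolding p_def[symmetric] q_def[symmetric] r_def[symmetric] by (simp_all add: field_simps)
  have rp: "r \<noteq> p" using y1 w1 assms by auto
  then show "node_val (node w) \<noteq> node_val (node y)" using x z by (simp add: x_def z_def)
  have xz: "x \<noteq> z" using rp x z by auto
  have "z * x < 1" using x z by (simp add: mult_lt_1)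
  have d: "(w - y) / (r - p) = (p + r - p * r) / (p\<^sup>2 * r\<^sup>2)"
    unfolding y1 w1 using rp pos by (simp add: divide_simps power2_eq_square) (simp add: algebra_simps)
  have "w + y = (r - 1) / r\<^sup>2 - (q - 1) / q\<^sup>2" using y1(2) w1 by simp
  then have s: "w + y = (r - q) * ((r + q - r * q) / (r\<^sup>2 * q\<^sup>2))"
    using pos by (simp add: divide_simps power2_eq_square) (simp add: algebra_simps)
  have rq: "r - q = pair_wt z x * (1 - z * x) / (z * (1 + z) * (1 + x))"
    unfolding z(3)[symmetric] x(4)[symmetric]
    using x(1) z(1) by (simp add: node_val_def pair_wt_def divide_simps power2_eq_square) (simp add: algebra_simps)
  have k: "pair_kernel x z * (r - q) = (1 + x + z - x * z) * pair_wt z x / (z * (1 + z) * (1 + x))"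
    unfolding rq pair_kernel_def using x(1) z(1) \<open>z * x < 1\<close> by (simp add: divide_simps mult.commute[of x z])
  have "pair_kernel x z * ((w\<^sup>2 - y\<^sup>2) / (r - p)) = pair_kernel x z * (w + y) * ((w - y) / (r - p))"
  proof -
    have "w\<^sup>2 - y\<^sup>2 = (w + y) * (w - y)" by (simp add: power2_eq_square algebra_simps)
    then show ?thesis by (simp only: times_divide_eq_right mult.assoc)
  qed
  also have "\<dots> = (pair_kernel x z * (r - q)) * ((r + q - r * q) / (r\<^sup>2 * q\<^sup>2)) * ((p + r - p * r) / (p\<^sup>2 * r\<^sup>2))"
    unfolding d s by (simp only: mult_ac)
  also have "\<dots> = pair_reg x z"
    unfolding k pair_reg_def x(3) z(3) x(4)[unfolded x(3)] by (simp only: mult_ac)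
  finally show "pair_kernel (node y) (node w) * ((w\<^sup>2 - y\<^sup>2) / (node_val (node w) - node_val (node y))) = pair_reg (node y) (node w)"
    by (simp only: x z x_def[symmetric] z_def[symmetric])
qed

definition row_fun :: "nat \<Rightarrow> nat \<Rightarrow> real \<Rightarrow> real" where
  "row_fun M r y = y ^ r * (1 / half_root y) ^ (M + 2 * r) - (-y) ^ r * (1 / half_root (-y)) ^ (M + 2 * r)"

lemma sum_odd_part:
  fixes h :: "nat \<Rightarrow> real"
  shows "(\<Sum>s<2*n. h s * y ^ s) - (\<Sum>s<2*n. h s * (-y) ^ s) = (\<Sum>l<n. 2 * h (2*l+1) * y ^ (2*l+1))"
  by (induction n) (simp_all add: algebra_simps power_minus[of y])

text \<open>The factor \<open>y ^ r\<close> raises the order, so the Catalan power is expanded only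
  to order \<open>2*n - r\<close>. Even powers cancel between \<open>y\<close> and
  \<open>-y\<close>.\<close>

lemma row_fun_expansion:
  assumes "r < n"
  shows "(\<lambda>y. row_fun M r y - (\<Sum>l<n. 2 * ballot_entry M l r * y ^ (2*l+1))) \<in> O[at_right 0](\<lambda>y. y ^ (2*n))"
proof -
  let ?j = "M + 2 * r"
  define E where "E y = (1 / half_root y) ^ ?j - (\<Sum>m<2*n-r. ballot ?j m * y ^ m)" for y
  define h where "h s = (if r \<le> s then ballot ?j (s - r) else 0)" for s
  have pw: "y ^ (2*n) = y ^ r * y ^ (2*n-r)" for y :: real
    using assms by (simp add: power_add[symmetric])
  have 1: "(\<lambda>y. y ^ r * E y) \<in> O[at 0](\<lambda>y. y ^ (2*n))"
    unfolding pw E_def by (intro landau_o.big.mult landau_o.big_refl inverse_half_root_expansion)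
  have "filterlim uminus (at (0::real)) (at 0)"
    unfolding filterlim_at by (auto intro!: tendsto_eq_intros simp: eventually_at_filter)
  from landau_o.big.compose[OF 1 this] have 2: "(\<lambda>y. (-y) ^ r * E (-y)) \<in> O[at 0](\<lambda>y. y ^ (2*n))" by simp
  have 3: "(\<lambda>y. y ^ r * E y - (-y) ^ r * E (-y)) \<in> O[at 0](\<lambda>y. y ^ (2*n))"
    using 1 2 by (rule sum_in_bigo(2))
  have h: "y ^ r * (\<Sum>m<2*n-r. ballot ?j m * y ^ m) = (\<Sum>s<2*n. h s * y ^ s)" for y :: real
  proof -
    have "(\<Sum>s<2*n. h s * y ^ s) = (\<Sum>s\<in>{r..<2*n}. h s * y ^ s)"
      by (intro sum.mono_neutral_right) (auto simp: h_def)
    also have "\<dots> = (\<Sum>m<2*n-r. h (m + r) * y ^ (m + r))"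
      by (intro sum.reindex_bij_witness[of _ "\<lambda>m. m + r" "\<lambda>s. s - r"]) auto
    finally show ?thesis by (simp add: h_def sum_distrib_left power_add mult_ac)
  qed
  have "y ^ r * E y - (-y) ^ r * E (-y) = row_fun M r y - (\<Sum>l<n. 2 * ballot_entry M l r * y ^ (2*l+1))" for y
  proof -
    have "y ^ r * E y - (-y) ^ r * E (-y) = row_fun M r y -
       (y ^ r * (\<Sum>m<2*n-r. ballot ?j m * y ^ m) - (-y) ^ r * (\<Sum>m<2*n-r. ballot ?j m * (-y) ^ m))"
      by (simp only: E_def row_fun_def algebra_simps)
    also have "\<dots> = row_fun M r y - (\<Sum>l<n. 2 * h (2*l+1) * y ^ (2*l+1))"
      unfolding h sum_odd_part ..
    finally show ?thesis by (simp only: h_def ballot_entry_def)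
  qed
  with 3 have "(\<lambda>y. row_fun M r y - (\<Sum>l<n. 2 * ballot_entry M l r * y ^ (2*l+1))) \<in> O[at 0](\<lambda>y. y ^ (2*n))" by simp
  then show ?thesis by (rule landau_o.big.filter_mono[rotated]) (simp add: at_le)
qed

lemma strict_sum_node:
  fixes y :: "nat \<Rightarrow> real"
  assumes y: "\<And>i. i < n \<Longrightarrow> 0 < y i \<and> y i < 1/4" and inj: "inj_on y {..<n}" and MN: "M + n = N + 1"
  shows "strict_sum (\<lambda>i. node (y i)) N {..<n} =
     (\<Prod>i<n. y i / (1 - node (y i)) * (half_root (y i)) ^ M) * (\<Prod>(i, j)\<in>pairs {..<n}. pair_reg (node (y i)) (node (y j))) *
     (det (mat n n (\<lambda>(i, r). row_fun M r (y i))) / det (mat n n (\<lambda>(i, l). y i ^ (2*l+1))))"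
proof -
  let ?x = "\<lambda>i. node (y i)"
  let ?p = "\<lambda>i. node_val (?x i)"
  have x: "\<forall>i<n. 0 < ?x i \<and> ?x i < 1" using node_props y by blast
  have yne: "y i \<noteq> y j" if "(i, j) \<in> pairs {..<n}" for i j
    using inj that by (auto simp: pairs_def inj_on_def)
  have pr: "?p j \<noteq> ?p i" "pair_kernel (?x i) (?x j) * (((y j)\<^sup>2 - (y i)\<^sup>2) / (?p j - ?p i)) = pair_reg (?x i) (?x j)"
    if "(i, j) \<in> pairs {..<n}" for i j
    using pair_kernel_eq_pair_reg[of "y i" "y j"] y yne[OF that] that by (auto simp: pairs_def)
  have injx: "inj_on ?x {..<n}"
  proof (rule inj_onI, rule ccontr)
    fix i j assume "i \<in> {..<n}" "j \<in> {..<n}" "?x i = ?x j" "i \<noteq> j"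
    then show False using pr(1)[of i j] pr(1)[of j i] by (cases "i < j") (auto simp: pairs_def)
  qed
  have e: "int N - int (card {..<n}) + 1 = int M" using MN by simp
  \<comment> \<open>With shift 1 the entries are \<open>v ^ r - x ^ M * w ^ r\<close>; taking
    \<open>half_root (y i) ^ M = (1 + v) ^ (-M)\<close> out of each row leaves
    \<open>row_fun\<close>.\<close>
  have "mat n n (\<lambda>(i, r). (?p i - 1) ^ r - ?x i powi int M * (?x i * ?p i - 1) ^ r) =
    mat n n (\<lambda>(i, r). half_root (y i) ^ M * 1 * row_fun M r (y i))"
  proof (intro cong_mat refl, clarify)
    fix i r assume "i < n"
    then have yi: "0 < y i" "y i < 1/4" using y by auto
    have a: "half_root (y i) > 0" "half_root (- y i) > 0" using half_root_props(1)[of "y i"] half_root_props(1)[of "- y i"] yi by auto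
    have 1: "?p i - 1 = y i * (1 / half_root (y i))\<^sup>2" "?x i * ?p i - 1 = - y i * (1 / half_root (- y i))\<^sup>2"
      using half_root_props(3)[of "y i"] half_root_props(3)[of "- y i"] node_props(3,4)[of "y i"] yi by auto
    show "(?p i - 1) ^ r - ?x i powi int M * (?x i * ?p i - 1) ^ r = half_root (y i) ^ M * 1 * row_fun M r (y i)"
    proof -
      define u w where "u = 1 / half_root (y i)" and "w = 1 / half_root (- y i)"
      have e1: "(s * t\<^sup>2) ^ r = s ^ r * t ^ (2 * r)" for s t :: real
        by (simp only: power_mult_distrib power_mult)
      have e2: "half_root (y i) ^ M * u ^ M = 1" "(node (y i)) ^ M = half_root (y i) ^ M * w ^ M"
        using a by (simp_all add: u_def w_def node_def power_divide)
      have "half_root (y i) ^ M * 1 * row_fun M r (y i) =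
         (half_root (y i) ^ M * u ^ M) * (y i ^ r * u ^ (2 * r)) - (half_root (y i) ^ M * w ^ M) * ((- y i) ^ r * w ^ (2 * r))"
        unfolding row_fun_def u_def[symmetric] w_def[symmetric] power_add by (simp only: algebra_simps)
      then show ?thesis
        unfolding 1 u_def[symmetric] w_def[symmetric] e1 e2 power_int_of_nat by simp
    qed
  qed
  then have d1: "subset_sum ?x (int M) {..<n} * (\<Prod>(i, j)\<in>pairs {..<n}. ?p j - ?p i) =
    (\<Prod>i<n. half_root (y i) ^ M) * det (mat n n (\<lambda>(i, r). row_fun M r (y i)))"
    using subset_sum_det[OF x injx, of "int M" 1] by (simp only: det_scale_rows_cols) simp
  have "mat n n (\<lambda>(i, l). y i ^ (2*l+1)) = mat n n (\<lambda>(i, l). y i * 1 * ((y i)\<^sup>2) ^ l)"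
    by (intro cong_mat) (auto simp: power_mult[symmetric])
  \<comment> \<open>The Vandermonde product in \<open>(y i)\<^sup>2\<close> regularizes the kernels
    and the extra product of the \<open>y i\<close> regularizes the factors
    \<open>1 / (1 - x i)\<close>.\<close>
  then have d2: "det (mat n n (\<lambda>(i, l). y i ^ (2*l+1))) = (\<Prod>i<n. y i) * (\<Prod>(i, j)\<in>pairs {..<n}. (y j)\<^sup>2 - (y i)\<^sup>2)"
    by (simp only: det_scale_rows_cols det_vandermonde) simp
  have "(y j)\<^sup>2 \<noteq> (y i)\<^sup>2" if "(i, j) \<in> pairs {..<n}" for i j
    using yne[OF that] y[of i] y[of j] that by (auto simp: pairs_def power2_eq_iff)
  then have nz: "(\<Prod>i<n. y i) \<noteq> 0" "(\<Prod>(i, j)\<in>pairs {..<n}. (y j)\<^sup>2 - (y i)\<^sup>2) \<noteq> 0"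
    "(\<Prod>(i, j)\<in>pairs {..<n}. ?p j - ?p i) \<noteq> 0"
    using y pr(1) by (force, auto)
  have "(\<Prod>(i, j)\<in>pairs {..<n}. pair_reg (?x i) (?x j)) =
     (\<Prod>(i, j)\<in>pairs {..<n}. pair_kernel (?x i) (?x j)) * ((\<Prod>(i, j)\<in>pairs {..<n}. (y j)\<^sup>2 - (y i)\<^sup>2) / (\<Prod>(i, j)\<in>pairs {..<n}. ?p j - ?p i))"
    unfolding prod_dividef[symmetric] prod.distrib[symmetric]
    using pr(2) by (intro prod.cong) auto
  moreover have "subset_sum ?x (int M) {..<n} = (\<Prod>i<n. half_root (y i) ^ M) * det (mat n n (\<lambda>(i, r). row_fun M r (y i))) /
     (\<Prod>(i, j)\<in>pairs {..<n}. ?p j - ?p i)"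
    using d1 nz(3) by (simp add: field_simps)
  moreover have "strict_sum ?x N {..<n} = subset_factor ?x {..<n} * subset_sum ?x (int M) {..<n}"
    using strict_sum_eq[of "{..<n}" ?x N] x injx unfolding e by simp
  ultimately show ?thesis
    unfolding d2 subset_factor_def
    using nz by (simp add: prod.distrib prod_dividef)
qed

theorem sum_agt_gf:
  assumes "M + n = N + 1"
  shows "(\<Sum>ks\<in>strict_lists n N. agt_gf (replicate n 1) ks) = 2 ^ n * ballot_det M n"
proof -
  \<comment> \<open>Distinct multiples of \<open>e\<close> keep the variables distinct for
    \<open>e > 0\<close> while all of them tend to 1.\<close>
  define y where "y e i = e * real (i + 1)" for e :: real and i :: nat
  let ?x = "\<lambda>e i. node (y e i)"
  have y0: "((\<lambda>e. y e i) \<longlongrightarrow> 0) (at_right 0)" for i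
    unfolding y_def by (auto intro!: tendsto_eq_intros)
  have a1: "((\<lambda>e. half_root (y e i)) \<longlongrightarrow> 1) (at_right 0)" "((\<lambda>e. half_root (- y e i)) \<longlongrightarrow> 1) (at_right 0)" for i
    using tendsto_minus[OF y0] by (auto intro!: tendsto_half_root y0)
  have x1: "((\<lambda>e. ?x e i) \<longlongrightarrow> 1) (at_right 0)" for i
    unfolding node_def by (auto intro!: tendsto_eq_intros a1)
  have p1: "((\<lambda>e. node_val (?x e i)) \<longlongrightarrow> 1) (at_right 0)" for i
    unfolding node_val_def by (auto intro!: tendsto_eq_intros x1)
  have small: "\<forall>\<^sub>F e in at_right 0. e > 0 \<and> (\<forall>i<n. 0 < y e i \<and> y e i < 1/4)"
  proof (intro eventually_conj eventually_at_right_less)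
    have "\<forall>\<^sub>F e in at_right 0. 0 < y e i \<and> y e i < 1/4" for i
    proof -
      have "\<forall>\<^sub>F e in at_right 0. y e i < 1/4" by (rule order_tendstoD(2)[OF y0]) simp
      with eventually_at_right_less[of "0::real"] show ?thesis
        by eventually_elim (simp add: y_def)
    qed
    then have "\<forall>\<^sub>F e in at_right 0. \<forall>i\<in>{..<n}. 0 < y e i \<and> y e i < 1/4"
      by (intro eventually_ball_finite) auto
    then show "\<forall>\<^sub>F e in at_right 0. \<forall>i<n. 0 < y e i \<and> y e i < 1/4"
      by eventually_elim auto
  qed
  let ?rhs = "\<lambda>e. (\<Prod>i<n. ?x e i + 1 / ?x e i) *
     ((\<Prod>i<n. half_root (- y e i) * (sqrt (1 + 4 * y e i) + sqrt (1 - 4 * y e i)) / 4 * (half_root (y e i)) ^ M) *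
      (\<Prod>(i, j)\<in>pairs {..<n}. pair_reg (?x e i) (?x e j)) *
     (det (mat n n (\<lambda>(i, r). row_fun M r (y e i))) / det (mat n n (\<lambda>(i, l). y e i ^ (2*l+1)))))"
  have eq: "\<forall>\<^sub>F e in at_right 0. ?rhs e = (\<Sum>ks\<in>strict_lists n N. agt_gf (map (?x e) [0..<n]) ks)"
    using small
  proof eventually_elim
    case (elim e)
    have inj: "inj_on (y e) {..<n}" using elim by (auto simp: inj_on_def y_def)
    have injx: "inj_on (?x e) {..<n}"
    proof (rule inj_onI, rule ccontr)
      fix i j assume ij: "i \<in> {..<n}" "j \<in> {..<n}" "?x e i = ?x e j" "i \<noteq> j"
      then have "y e i \<noteq> y e j" using inj by (auto simp: inj_on_def)
      with pair_kernel_eq_pair_reg(1)[of "y e i" "y e j"] elim ij show False by auto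
    qed
    have xpos: "?x e i > 0" if "i < n" for i using elim that node_props(1) by blast
    have "(\<Sum>ks\<in>strict_lists n N. agt_gf (map (?x e) [0..<n]) ks) =
       (\<Sum>ks\<in>strict_lists n N. (\<Prod>i<n. ?x e i + 1 / ?x e i) * sym_gf (?x e) {..<n} ks)"
    proof (intro sum.cong refl)
      fix ks assume "ks \<in> strict_lists n N"
      then have "length ks = length [0..<n]" by (simp add: strict_lists_def)
      then show "agt_gf (map (?x e) [0..<n]) ks = (\<Prod>i<n. ?x e i + 1 / ?x e i) * sym_gf (?x e) {..<n} ks"
        using xpos injx by (subst agt_gf_eq) (force simp: atLeast0LessThan)+
    qed
    also have "\<dots> = (\<Prod>i<n. ?x e i + 1 / ?x e i) * strict_sum (?x e) N {..<n}"
      by (simp add: strict_sum_def sum_distrib_left)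
    also have "strict_sum (?x e) N {..<n} =
       (\<Prod>i<n. y e i / (1 - ?x e i) * (half_root (y e i)) ^ M) * (\<Prod>(i, j)\<in>pairs {..<n}. pair_reg (?x e i) (?x e j)) *
     (det (mat n n (\<lambda>(i, r). row_fun M r (y e i))) / det (mat n n (\<lambda>(i, l). y e i ^ (2*l+1))))"
      by (rule strict_sum_node[OF _ inj assms]) (use elim in auto)
    also have "(\<Prod>i<n. y e i / (1 - ?x e i) * (half_root (y e i)) ^ M) =
      (\<Prod>i<n. half_root (- y e i) * (sqrt (1 + 4 * y e i) + sqrt (1 - 4 * y e i)) / 4 * (half_root (y e i)) ^ M)"
      by (intro prod.cong refl arg_cong2[where f = "(*)"] node_props(5)) (use elim in auto)
    finally show ?case ..
  qed
  have lim1: "((\<lambda>e. \<Sum>ks\<in>strict_lists n N. agt_gf (map (?x e) [0..<n]) ks) \<longlongrightarrow>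
     (\<Sum>ks\<in>strict_lists n N. agt_gf (replicate n 1) ks)) (at_right 0)"
  proof (intro tendsto_sum)
    fix ks
    show "((\<lambda>e. agt_gf (map (?x e) [0..<n]) ks) \<longlongrightarrow> agt_gf (replicate n 1) ks) (at_right 0)"
      using tendsto_agt_gf[where x = ?x and F = "at_right 0" and js = "[0..<n]" and ks = ks] x1 by simp
  qed
  \<comment> \<open>The limits 2 of \<open>x + 1/x\<close> and 1/2 of the regularized single factors
    cancel; the final \<open>2 ^ n\<close> comes from the determinant.\<close>
  have lim2: "(?rhs \<longlongrightarrow> (\<Prod>i<n. 2) * ((\<Prod>i<n. 1 / 2) * (\<Prod>(i, j)\<in>pairs {..<n}. 1) *
      det (mat n n (\<lambda>(l, r). 2 * ballot_entry M l r)))) (at_right 0)"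
  proof (intro tendsto_mult tendsto_prod)
    fix i
    show "((\<lambda>e. ?x e i + 1 / ?x e i) \<longlongrightarrow> 2) (at_right 0)"
      by (auto intro!: tendsto_eq_intros x1)
    show "((\<lambda>e. half_root (- y e i) * (sqrt (1 + 4 * y e i) + sqrt (1 - 4 * y e i)) / 4 * (half_root (y e i)) ^ M) \<longlongrightarrow> 1 / 2) (at_right 0)"
      by (auto intro!: tendsto_eq_intros y0 a1)
  next
    have "((\<lambda>e. pair_reg (?x e i) (?x e j)) \<longlongrightarrow> 1) (at_right 0)" for i j
      unfolding pair_reg_def pair_wt_def by (auto intro!: tendsto_eq_intros x1 p1)
    then show "((\<lambda>e. case ij of (i, j) \<Rightarrow> pair_reg (?x e i) (?x e j)) \<longlongrightarrow> (case ij of (i, j) \<Rightarrow> 1)) (at_right 0)" for ij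
      by (cases ij) simp
    show "((\<lambda>e. det (mat n n (\<lambda>(i, r). row_fun M r (y e i))) / det (mat n n (\<lambda>(i, l). y e i ^ (2*l+1))))
      \<longlongrightarrow> det (mat n n (\<lambda>(l, r). 2 * ballot_entry M l r))) (at_right 0)"
      unfolding y_def by (rule det_confluent_limit[OF row_fun_expansion])
  qed
  have "(\<Sum>ks\<in>strict_lists n N. agt_gf (replicate n 1) ks) = (\<Prod>i<n. 2) * ((\<Prod>i<n. 1 / 2) * (\<Prod>(i, j)\<in>pairs {..<n}. 1) *
      det (mat n n (\<lambda>(l, r). 2 * ballot_entry M l r)))"
    by (rule tendsto_unique[OF trivial_limit_at_right_real lim1 Lim_transform_eventually[OF lim2 eq]])
  also have "mat n n (\<lambda>(l, r). 2 * ballot_entry M l r) = mat n n (\<lambda>(l, r). 2 * 1 * ballot_entry M l r)" by simp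
  also have "det \<dots> = 2 ^ n * ballot_det M n"
    unfolding ballot_det_def det_scale_rows_cols by simp
  finally show ?thesis by (simp add: power_one_over)
qed

section \<open>From patterns to rows\<close>

text \<open>The coefficients of an extended sum.\<close>

definition signed_ind :: "int \<Rightarrow> int \<Rightarrow> int \<Rightarrow> real" where
  "signed_ind c b l = (if c \<le> l \<and> l \<le> b then 1 else if b < l \<and> l < c then -1 else 0)"

text \<open>An arrow may push a bound one step out of the box, to \<open>M + 1\<close> or
  \<open>-1\<close>; the summation range and the gap still lie in \<open>{0..M}\<close>.\<close>

lemma esum_eq_signed_ind:
  assumes "0 \<le> c" "c \<le> M + 1" "-1 \<le> b" "b \<le> M"
  shows "esum c b g = (\<Sum>l\<in>{0..M}. signed_ind c b l * g l)"
proof -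
  have "(\<Sum>l\<in>{0..M}. signed_ind c b l * g l) =
    (\<Sum>l\<in>{0..M}. (if l \<in> {c..b} then g l else 0) - (if l \<in> {b+1..c-1} then g l else 0))"
    by (intro sum.cong refl) (auto simp: signed_ind_def)
  also have "\<dots> = (\<Sum>l\<in>{0..M} \<inter> {c..b}. g l) - (\<Sum>l\<in>{0..M} \<inter> {b+1..c-1}. g l)"
    by (simp only: sum_subtractf sum.inter_restrict[OF finite_atLeastAtMost_int])
  also have "{0..M} \<inter> {c..b} = {c..b}" using assms by auto
  also have "{0..M} \<inter> {b+1..c-1} = {b+1..c-1}" using assms by auto
  finally show ?thesis by (simp add: esum_def)
qed

definition entry_ok :: "int \<Rightarrow> int \<Rightarrow> arrow \<Rightarrow> arrow \<Rightarrow> int \<Rightarrow> bool" where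
  "entry_ok k k' u u' l \<longleftrightarrow> k \<le> l \<and> l \<le> k' \<and> (k = l \<and> has_NE u \<longrightarrow> k' = k \<and> has_NW u') \<and>
     (k' = l \<and> has_NW u' \<longrightarrow> k = k' \<and> has_NE u)"

definition special :: "int \<Rightarrow> int \<Rightarrow> arrow \<Rightarrow> arrow \<Rightarrow> int \<Rightarrow> bool" where
  "special k k' u u' l \<longleftrightarrow> l = k \<and> l = k' \<and> has_NE u \<and> has_NW u'"

text \<open>Arrows pointing at the slot exclude the ends of the interval. The gap is nonempty only
  if \<open>k = k'\<close> and both arrows are present; then it is \<open>{k}\<close> and the sign
  is that of a special little triangle.\<close>

lemma signed_ind_entry:
  assumes "k \<le> k'"
  shows "signed_ind (k + ne_shift u) (k' - nw_shift u') l =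
     (if entry_ok k k' u u' l then (if special k k' u u' l then -1 else 1) else 0)"
proof -
  have 1: "k + of_bool a \<le> l \<and> l \<le> k' - of_bool b \<longleftrightarrow>
      (k \<le> l \<and> l \<le> k' \<and> (k = l \<and> a \<longrightarrow> k' = k \<and> b) \<and> (k' = l \<and> b \<longrightarrow> k = k' \<and> a)) \<and> \<not> (l = k \<and> l = k' \<and> a \<and> b)" for a b
    using assms by (cases a; cases b; simp only: of_bool_eq; presburger)
  have 2: "k' - of_bool b < l \<and> l < k + of_bool a \<longleftrightarrow> l = k \<and> l = k' \<and> a \<and> b" for a b
    using assms by (cases a; cases b; simp only: of_bool_eq; presburger)
  have 3: "(if A \<and> \<not> B then 1 else if B then -1 else (0::real)) = (if A then if B then -1 else 1 else 0)"
    if "B \<Longrightarrow> A" for A B using that by auto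
  show ?thesis
    unfolding signed_ind_def ne_shift_def nw_shift_def 1 2 entry_ok_def special_def by (rule 3) (metis order_refl)
qed

lemma entry_okD:
  assumes "entry_ok k k' u u' l"
  shows "k \<le> l" "l \<le> k'" "k = l \<Longrightarrow> has_NE u \<Longrightarrow> k' = k \<and> has_NW u'"
    "k' = l \<Longrightarrow> has_NW u' \<Longrightarrow> k = k' \<and> has_NE u"
  using assms unfolding entry_ok_def by blast+

text \<open>Every condition concerns one entry and its two lower neighbours; the conditions are
  regrouped by that upper entry.\<close>

lemma is_arrowed_GT_iff:
  "is_arrowed_GT n a d \<longleftrightarrow>
     (\<forall>i j. 1 \<le> j \<and> j \<le> i \<and> i < n \<longrightarrow> entry_ok (a (Suc i) j) (a (Suc i) (Suc j)) (d (Suc i) j) (d (Suc i) (Suc j)) (a i j))"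
  (is "?L = ?R")
proof
  assume L: ?L
  show ?R
  proof (intro allI impI)
    fix i j assume ij: "1 \<le> j \<and> j \<le> i \<and> i < n"
    have tri: "in_tri n (Suc i) j" "in_tri n (Suc i) (Suc j)" using ij by (auto simp: in_tri_def)
    have "a (Suc i) j \<le> a i j" "a i j \<le> a (Suc i) (Suc j)"
      using L ij by (auto simp: is_arrowed_GT_def is_GT_def)
    moreover have "a (Suc i) j = a i j \<Longrightarrow> has_NE (d (Suc i) j) \<Longrightarrow>
        a (Suc i) (Suc j) = a (Suc i) j \<and> has_NW (d (Suc i) (Suc j))"
      using L[unfolded is_arrowed_GT_def, THEN conjunct2, THEN conjunct1, THEN spec, THEN spec, of "Suc i" j] ij tri by auto
    moreover have "a (Suc i) (Suc j) = a i j \<Longrightarrow> has_NW (d (Suc i) (Suc j)) \<Longrightarrow>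
        a (Suc i) j = a (Suc i) (Suc j) \<and> has_NE (d (Suc i) j)"
      using L[unfolded is_arrowed_GT_def, THEN conjunct2, THEN conjunct2, THEN spec, THEN spec, of "Suc i" "Suc j"] ij tri by auto
    ultimately show "entry_ok (a (Suc i) j) (a (Suc i) (Suc j)) (d (Suc i) j) (d (Suc i) (Suc j)) (a i j)"
      unfolding entry_ok_def by blast
  qed
next
  assume R: ?R
  then have R': "entry_ok (a i j) (a i (Suc j)) (d i j) (d i (Suc j)) (a (i - 1) j)" if "1 \<le> j" "j \<le> i - 1" "i \<le> n" "2 \<le> i" for i j
    using that by (cases i) auto
  show ?L
    unfolding is_arrowed_GT_def
  proof (intro conjI allI impI)
    show "is_GT n a"
      unfolding is_GT_def using R entry_okD(1,2) by simp blast
  next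
    fix i j assume *: "in_tri n i j \<and> 2 \<le> i \<and> j \<le> i - 1 \<and> a i j = a (i - 1) j \<and> has_NE (d i j)"
    then have ok: "entry_ok (a i j) (a i (Suc j)) (d i j) (d i (Suc j)) (a (i - 1) j)"
      by (intro R') (auto simp: in_tri_def)
    show "j + 1 \<le> i" using * by linarith
    show "a i (j + 1) = a i j" "has_NW (d i (j + 1))"
      using entry_okD(3)[OF ok] * by (simp_all only: Suc_eq_plus1)
  next
    fix i j assume *: "in_tri n i j \<and> 2 \<le> i \<and> 2 \<le> j \<and> a i j = a (i - 1) (j - 1) \<and> has_NW (d i j)"
    then have "entry_ok (a i (j - 1)) (a i (Suc (j - 1))) (d i (j - 1)) (d i (Suc (j - 1))) (a (i - 1) (j - 1))"
      by (intro R') (auto simp: in_tri_def)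
    moreover have "Suc (j - 1) = j" using * by linarith
    ultimately have ok: "entry_ok (a i (j - 1)) (a i j) (d i (j - 1)) (d i j) (a (i - 1) (j - 1))" by simp
    show "a i (j - 1) = a i j" "has_NE (d i (j - 1))"
      using entry_okD(4)[OF ok] * by blast+
  qed
qed

definition agt_wt :: "nat \<Rightarrow> (nat \<Rightarrow> nat \<Rightarrow> int) \<Rightarrow> (nat \<Rightarrow> nat \<Rightarrow> arrow) \<Rightarrow> real" where
  "agt_wt n a d =
     (\<Prod>i\<in>{1..<n}. \<Prod>j\<in>{1..i}. if special (a (Suc i) j) (a (Suc i) (Suc j)) (d (Suc i) j) (d (Suc i) (Suc j)) (a i j) then -1 else 1) *
     (\<Prod>i\<in>{1..n}. \<Prod>j\<in>{1..i}. arrow_wt (d i j))"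

lemma minus_one_power_card:
  "finite A \<Longrightarrow> (-1) ^ card {x \<in> A. P x} = (\<Prod>x\<in>A. if P x then -1 else 1 :: real)"
  by (simp add: prod.If_cases Int_def)

lemma agt_wt_eq: "real_of_int (sgn_AGT n a d * (-1) ^ card (double_arrows n d)) = agt_wt n a d"
proof -
  have "special_triangles n a d = {x \<in> (SIGMA i:{1..<n}. {1..i}). case x of (i, j) \<Rightarrow>
      special (a (Suc i) j) (a (Suc i) (Suc j)) (d (Suc i) j) (d (Suc i) (Suc j)) (a i j)}"
    by (auto simp: special_triangles_def special_def in_tri_def)
  then have "(-1) ^ card (special_triangles n a d) = (\<Prod>i\<in>{1..<n}. \<Prod>j\<in>{1..i}.
      if special (a (Suc i) j) (a (Suc i) (Suc j)) (d (Suc i) j) (d (Suc i) (Suc j)) (a i j) then -1 else 1 :: real)"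
    by (simp add: minus_one_power_card prod.Sigma split_def)
  moreover have "double_arrows n d = {x \<in> (SIGMA i:{1..n}. {1..i}). case x of (i, j) \<Rightarrow> d i j = ArrDB}"
    by (auto simp: double_arrows_def in_tri_def)
  then have "(-1) ^ card (double_arrows n d) = (\<Prod>i\<in>{1..n}. \<Prod>j\<in>{1..i}. arrow_wt (d i j))"
    by (simp add: minus_one_power_card prod.Sigma split_def arrow_wt_def)
  ultimately show ?thesis by (simp add: agt_wt_def sgn_AGT_def)
qed

fun row_wt :: "int \<Rightarrow> int list \<Rightarrow> arrow list \<Rightarrow> int list \<Rightarrow> real" where
  "row_wt c (k # ks) (u # us) (l # ls) = arrow_wt u * signed_ind c (k - nw_shift u) l * row_wt (k + ne_shift u) ks us ls"
| "row_wt c _ _ _ = 1"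

abbreviation box_lists :: "int \<Rightarrow> nat \<Rightarrow> int list set" where
  "box_lists M n \<equiv> {ls. set ls \<subseteq> {0..M} \<and> length ls = n}"

text \<open>Written as an inclusion so that \<open>sum_lists_Suc\<close> peels off arrows in the
  same way as entries.\<close>

abbreviation arrow_lists :: "nat \<Rightarrow> arrow list set" where
  "arrow_lists n \<equiv> {us. set us \<subseteq> UNIV \<and> length us = n}"

lemma sum_lists_Suc:
  fixes f :: "'a list \<Rightarrow> real"
  assumes "finite A"
  shows "(\<Sum>xs | set xs \<subseteq> A \<and> length xs = Suc n. f xs) = (\<Sum>x\<in>A. \<Sum>xs | set xs \<subseteq> A \<and> length xs = n. f (x # xs))"
proof -
  have "(\<Sum>x\<in>A. \<Sum>xs | set xs \<subseteq> A \<and> length xs = n. f (x # xs)) =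
    (\<Sum>(x, xs)\<in>A \<times> {xs. set xs \<subseteq> A \<and> length xs = n}. f (x # xs))"
    using assms by (subst sum.cartesian_product) simp
  also have "\<dots> = (\<Sum>xs | set xs \<subseteq> A \<and> length xs = Suc n. f xs)"
    by (rule sum.reindex_bij_witness[of _ "\<lambda>xs. (hd xs, tl xs)" "\<lambda>(x, xs). x # xs"])
       (auto simp: length_Suc_conv)
  finally show ?thesis ..
qed

lemma shift_bounds: "0 \<le> ne_shift u" "ne_shift u \<le> 1" "0 \<le> nw_shift u" "nw_shift u \<le> 1"
  by (simp_all add: ne_shift_def nw_shift_def)

text \<open>At \<open>z = 1\<close> the powers disappear and the nested extended sums unfold into
  one sum over arrows and upper entries. The bound on \<open>c\<close> persists, since an arrow
  shifts an entry of the box by at most 1.\<close>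

lemma row_from_expand:
  assumes "set ks \<subseteq> {0..M}" "0 \<le> c" "c \<le> M + 1"
  shows "row_from 1 c ks f =
    (\<Sum>us\<in>arrow_lists (length ks). \<Sum>ls\<in>box_lists M (length ks). row_wt c ks us ls * f ls)"
  using assms
proof (induction ks arbitrary: c f)
  case Nil
  have "{us :: arrow list. us = []} = {[]}" "{ls :: int list. set ls \<subseteq> {0..M} \<and> ls = []} = {[]}" by auto
  then show ?case by simp
next
  case (Cons k ks)
  let ?n = "length ks"
  have IH: "row_from 1 (k + ne_shift u) ks (\<lambda>ls. f (l # ls)) =
    (\<Sum>us\<in>arrow_lists ?n. \<Sum>ls\<in>box_lists M ?n. row_wt (k + ne_shift u) ks us ls * f (l # ls))" for u l
    using Cons.prems shift_bounds[of u] by (intro Cons.IH) auto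
  have "row_from 1 c (k # ks) f = (\<Sum>u\<in>UNIV. arrow_wt u * (\<Sum>l\<in>{0..M}. signed_ind c (k - nw_shift u) l *
     (\<Sum>us\<in>arrow_lists ?n. \<Sum>ls\<in>box_lists M ?n. row_wt (k + ne_shift u) ks us ls * f (l # ls))))"
    unfolding row_from.simps IH
  proof (intro sum.cong refl)
    fix u :: arrow
    show "arrow_wt u * 1 powi (k + ne_shift u - nw_shift u) * esum c (k - nw_shift u)
       (\<lambda>l. 1 powi - l * (\<Sum>us\<in>arrow_lists ?n. \<Sum>ls\<in>box_lists M ?n. row_wt (k + ne_shift u) ks us ls * f (l # ls))) =
      arrow_wt u * (\<Sum>l\<in>{0..M}. signed_ind c (k - nw_shift u) l *
     (\<Sum>us\<in>arrow_lists ?n. \<Sum>ls\<in>box_lists M ?n. row_wt (k + ne_shift u) ks us ls * f (l # ls)))"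
      using Cons.prems shift_bounds[of u] by (subst esum_eq_signed_ind[of _ M]) auto
  qed
  also have "\<dots> = (\<Sum>u\<in>UNIV. \<Sum>us\<in>arrow_lists ?n. \<Sum>l\<in>{0..M}. \<Sum>ls\<in>box_lists M ?n.
      row_wt c (k # ks) (u # us) (l # ls) * f (l # ls))"
    unfolding sum_distrib_left row_wt.simps
    by (intro sum.cong refl, subst sum.swap) (simp only: mult_ac)
  also have "\<dots> = (\<Sum>us\<in>arrow_lists (length (k # ks)). \<Sum>ls\<in>box_lists M (length (k # ks)). row_wt c (k # ks) us ls * f ls)"
    by (simp only: list.size(4) One_nat_def add_Suc_right add_0_right sum_lists_Suc[OF finite_UNIV] sum_lists_Suc[OF finite_atLeastAtMost_int])
  finally show ?case .
qed

text \<open>The lower bound of each upper entry comes from the preceding slot, hence the lists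
  prolonged by \<open>k\<close> and \<open>u\<close>.\<close>

lemma row_wt_nth:
  assumes "length us = length ks" "length ls = length ks"
  shows "row_wt (k + ne_shift u) ks us ls = (\<Prod>j<length ks. arrow_wt (us ! j)) *
    (\<Prod>j<length ks. signed_ind ((k # ks) ! j + ne_shift ((u # us) ! j)) (ks ! j - nw_shift (us ! j)) (ls ! j))"
  using assms
proof (induction ks arbitrary: k u us ls)
  case (Cons k' ks)
  obtain u' us' where us: "us = u' # us'" using Cons.prems by (cases us) auto
  obtain l' ls' where ls: "ls = l' # ls'" using Cons.prems by (cases ls) auto
  have "row_wt (k' + ne_shift u') ks us' ls' = (\<Prod>j<length ks. arrow_wt (us' ! j)) *
    (\<Prod>j<length ks. signed_ind ((k' # ks) ! j + ne_shift ((u' # us') ! j)) (ks ! j - nw_shift (us' ! j)) (ls' ! j))"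
    by (rule Cons.IH) (use Cons.prems us ls in auto)
  then show ?case unfolding us ls
    by (simp only: row_wt.simps list.size(4) One_nat_def add_Suc_right add_0_right prod.lessThan_Suc_shift nth_Cons_0 nth_Cons_Suc mult_ac)
qed simp

lemma row_step_expand:
  assumes "length ks = Suc n" "set ks \<subseteq> {0..M}"
  shows "row_step 1 ks f = (\<Sum>us\<in>arrow_lists (Suc n). \<Sum>ls\<in>box_lists M n.
     (\<Prod>j\<le>n. arrow_wt (us ! j)) * (\<Prod>j<n. signed_ind (ks ! j + ne_shift (us ! j)) (ks ! Suc j - nw_shift (us ! Suc j)) (ls ! j)) * f ls)"
proof -
  obtain k ks' where ks: "ks = k # ks'" "length ks' = n" using assms(1) by (cases ks) auto
  have "row_step 1 ks f = (\<Sum>u\<in>UNIV. arrow_wt u * (\<Sum>us\<in>arrow_lists n. \<Sum>ls\<in>box_lists M n. row_wt (k + ne_shift u) ks' us ls * f ls))"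
    unfolding ks row_step.simps
  proof (intro sum.cong refl)
    fix u
    have "row_from 1 (k + ne_shift u) ks' f = (\<Sum>us\<in>arrow_lists n. \<Sum>ls\<in>box_lists M n. row_wt (k + ne_shift u) ks' us ls * f ls)"
      using assms(2) shift_bounds[of u] by (subst row_from_expand[of _ M]) (auto simp: ks)
    then show "arrow_wt u * 1 powi (k + ne_shift u - nw_shift u) * row_from 1 (k + ne_shift u) ks' f =
      arrow_wt u * (\<Sum>us\<in>arrow_lists n. \<Sum>ls\<in>box_lists M n. row_wt (k + ne_shift u) ks' us ls * f ls)" by simp
  qed
  also have "\<dots> = (\<Sum>u\<in>UNIV. \<Sum>us\<in>arrow_lists n. \<Sum>ls\<in>box_lists M n.
     (\<Prod>j\<le>n. arrow_wt ((u # us) ! j)) * (\<Prod>j<n. signed_ind (ks ! j + ne_shift ((u # us) ! j)) (ks ! Suc j - nw_shift ((u # us) ! Suc j)) (ls ! j)) * f ls)"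
    unfolding sum_distrib_left
  proof (intro sum.cong refl)
    fix u us ls assume "us \<in> arrow_lists n" "ls \<in> box_lists M n"
    moreover have "(\<Prod>j\<le>n. arrow_wt ((u # us) ! j)) = arrow_wt u * (\<Prod>j<n. arrow_wt (us ! j))"
      by (simp add: prod.lessThan_Suc_shift lessThan_Suc_atMost[symmetric] del: prod.lessThan_Suc)
    ultimately show "arrow_wt u * (row_wt (k + ne_shift u) ks' us ls * f ls) =
       (\<Prod>j\<le>n. arrow_wt ((u # us) ! j)) * (\<Prod>j<n. signed_ind (ks ! j + ne_shift ((u # us) ! j)) (ks ! Suc j - nw_shift ((u # us) ! Suc j)) (ls ! j)) * f ls"
      using ks by (subst row_wt_nth) simp_all
  qed
  also have "\<dots> = (\<Sum>us\<in>arrow_lists (Suc n). \<Sum>ls\<in>box_lists M n.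
     (\<Prod>j\<le>n. arrow_wt (us ! j)) * (\<Prod>j<n. signed_ind (ks ! j + ne_shift (us ! j)) (ks ! Suc j - nw_shift (us ! Suc j)) (ls ! j)) * f ls)"
    by (simp only: sum_lists_Suc[OF finite_UNIV])
  finally show ?thesis .
qed

section \<open>Removing the bottom row of a pattern\<close>

definition row_list :: "nat \<Rightarrow> (nat \<Rightarrow> nat \<Rightarrow> 'a) \<Rightarrow> 'a list" where
  "row_list n f = map (f n) [1..<Suc n]"

definition restrict_rows :: "'a \<Rightarrow> nat \<Rightarrow> (nat \<Rightarrow> nat \<Rightarrow> 'a) \<Rightarrow> nat \<Rightarrow> nat \<Rightarrow> 'a" where
  "restrict_rows z n f = (\<lambda>i j. if in_tri n i j then f i j else z)"

definition extend_row :: "nat \<Rightarrow> 'a list \<Rightarrow> (nat \<Rightarrow> nat \<Rightarrow> 'a) \<Rightarrow> nat \<Rightarrow> nat \<Rightarrow> 'a" where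
  "extend_row n xs f = (\<lambda>i j. if i = Suc n \<and> in_tri (Suc n) i j then xs ! (j - 1) else f i j)"

lemma length_row_list [simp]: "length (row_list n f) = n"
  by (simp add: row_list_def)

lemma nth_row_list [simp]: "j < n \<Longrightarrow> row_list n f ! j = f n (Suc j)"
  by (simp add: row_list_def del: upt_Suc)

lemma set_row_list: "set (row_list n f) = f n ` {1..n}"
  by (auto simp: row_list_def)

lemma in_tri_Suc: "in_tri (Suc n) i j \<longleftrightarrow> in_tri n i j \<or> i = Suc n \<and> 1 \<le> j \<and> j \<le> Suc n"
  by (auto simp: in_tri_def)

lemma extend_restrict_rows:
  assumes "\<forall>i j. \<not> in_tri (Suc n) i j \<longrightarrow> f i j = z"
  shows "extend_row n (row_list (Suc n) f) (restrict_rows z n f) = f"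
proof (intro HOL.ext)
  fix i j
  show "extend_row n (row_list (Suc n) f) (restrict_rows z n f) i j = f i j"
  proof (cases "i = Suc n \<and> in_tri (Suc n) i j")
    case True
    then have "j - 1 < Suc n" "Suc (j - 1) = j" by (auto simp: in_tri_def)
    then show ?thesis using True by (auto simp: extend_row_def)
  next
    case False
    then show ?thesis using assms by (auto simp: extend_row_def restrict_rows_def in_tri_Suc)
  qed
qed

lemma row_list_extend: "length xs = Suc n \<Longrightarrow> row_list (Suc n) (extend_row n xs f) = xs"
  by (rule nth_equalityI) (auto simp: extend_row_def in_tri_def)

lemma row_list_extend_lower: "row_list n (extend_row n xs f) = row_list n f"
  by (rule nth_equalityI) (auto simp: extend_row_def)

lemma restrict_extend_row: "\<forall>i j. \<not> in_tri n i j \<longrightarrow> f i j = z \<Longrightarrow> restrict_rows z n (extend_row n xs f) = f"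
  by (auto simp: restrict_rows_def extend_row_def in_tri_def fun_eq_iff)

lemma is_arrowed_GT_Suc:
  "is_arrowed_GT (Suc n) a d \<longleftrightarrow> is_arrowed_GT n a d \<and>
     (\<forall>j<n. entry_ok (row_list (Suc n) a ! j) (row_list (Suc n) a ! Suc j)
        (row_list (Suc n) d ! j) (row_list (Suc n) d ! Suc j) (row_list n a ! j))"
  (is "_ \<longleftrightarrow> _ \<and> ?Q")
proof -
  have "?Q \<longleftrightarrow> (\<forall>j. 1 \<le> j \<and> j \<le> n \<longrightarrow>
     entry_ok (a (Suc n) j) (a (Suc n) (Suc j)) (d (Suc n) j) (d (Suc n) (Suc j)) (a n j))" (is "_ \<longleftrightarrow> ?Q'")
  proof
    assume Q: ?Q
    show ?Q'
    proof (intro allI impI)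
      fix j assume "1 \<le> j \<and> j \<le> n"
      then obtain j' where "j = Suc j'" "j' < n" by (cases j) auto
      with Q show "entry_ok (a (Suc n) j) (a (Suc n) (Suc j)) (d (Suc n) j) (d (Suc n) (Suc j)) (a n j)"
        by simp
    qed
  qed simp
  then show ?thesis unfolding is_arrowed_GT_iff less_Suc_eq by blast
qed

lemma is_arrowed_GT_cong:
  assumes "\<And>i j. in_tri n i j \<Longrightarrow> a i j = a' i j" "\<And>i j. in_tri n i j \<Longrightarrow> d i j = d' i j"
  shows "is_arrowed_GT n a d \<longleftrightarrow> is_arrowed_GT n a' d'"
proof -
  have "a i j = a' i j" "a (Suc i) j = a' (Suc i) j" "a (Suc i) (Suc j) = a' (Suc i) (Suc j)"
      "d (Suc i) j = d' (Suc i) j" "d (Suc i) (Suc j) = d' (Suc i) (Suc j)"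
    if "1 \<le> j \<and> j \<le> i \<and> i < n" for i j
    using that by (auto intro!: assms simp: in_tri_def)
  then show ?thesis unfolding is_arrowed_GT_iff by metis
qed

lemma agt_wt_cong:
  assumes "\<And>i j. in_tri n i j \<Longrightarrow> a i j = a' i j" "\<And>i j. in_tri n i j \<Longrightarrow> d i j = d' i j"
  shows "agt_wt n a d = agt_wt n a' d'"
  unfolding agt_wt_def
  by (intro arg_cong2[where f = "(*)"] prod.cong refl if_cong arg_cong[where f = arrow_wt])
     (auto simp: in_tri_def assms)

definition sgn_row :: "int list \<Rightarrow> arrow list \<Rightarrow> int list \<Rightarrow> nat \<Rightarrow> real" where
  "sgn_row ks us ls n = (\<Prod>j<n. if special (ks ! j) (ks ! Suc j) (us ! j) (us ! Suc j) (ls ! j) then -1 else 1)"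

lemma agt_wt_Suc:
  "agt_wt (Suc n) a d = (\<Prod>j\<le>n. arrow_wt (row_list (Suc n) d ! j)) *
     sgn_row (row_list (Suc n) a) (row_list (Suc n) d) (row_list n a) n * agt_wt n a d"
proof -
  let ?s = "\<lambda>i j. if special (a (Suc i) j) (a (Suc i) (Suc j)) (d (Suc i) j) (d (Suc i) (Suc j)) (a i j) then -1 else (1::real)"
  have "sgn_row (row_list (Suc n) a) (row_list (Suc n) d) (row_list n a) n = (\<Prod>j<n. ?s n (Suc j))"
    unfolding sgn_row_def by (intro prod.cong) auto
  also have "\<dots> = (\<Prod>j\<in>{1..n}. ?s n j)"
    by (simp only: One_nat_def prod.atLeast1_atMost_eq)
  finally have 1: "sgn_row (row_list (Suc n) a) (row_list (Suc n) d) (row_list n a) n = (\<Prod>j\<in>{1..n}. ?s n j)" .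
  have "(\<Prod>j\<le>n. arrow_wt (row_list (Suc n) d ! j)) = (\<Prod>j<Suc n. arrow_wt (d (Suc n) (Suc j)))"
    unfolding lessThan_Suc_atMost[symmetric] by (intro prod.cong) auto
  also have "\<dots> = (\<Prod>j\<in>{1..Suc n}. arrow_wt (d (Suc n) j))"
    by (simp only: One_nat_def prod.atLeast1_atMost_eq)
  finally have 2: "(\<Prod>j\<le>n. arrow_wt (row_list (Suc n) d ! j)) = (\<Prod>j\<in>{1..Suc n}. arrow_wt (d (Suc n) j))" .
  have 3: "(\<Prod>i\<in>{1..<Suc n}. \<Prod>j\<in>{1..i}. ?s i j) = (\<Prod>i\<in>{1..<n}. \<Prod>j\<in>{1..i}. ?s i j) * (\<Prod>j\<in>{1..n}. ?s n j)"
    by (cases "n = 0") (simp_all del: prod.cl_ivl_Suc)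
  have 4: "(\<Prod>i\<in>{1..Suc n}. \<Prod>j\<in>{1..i}. arrow_wt (d i j)) = (\<Prod>i\<in>{1..n}. \<Prod>j\<in>{1..i}. arrow_wt (d i j)) * (\<Prod>j\<in>{1..Suc n}. arrow_wt (d (Suc n) j))"
    by (subst prod.cl_ivl_Suc) simp
  show ?thesis unfolding agt_wt_def 1 2 3 4 by (simp only: mult_ac)
qed

definition pat_set :: "nat \<Rightarrow> nat \<Rightarrow> int list \<Rightarrow> ((nat \<Rightarrow> nat \<Rightarrow> int) \<times> (nat \<Rightarrow> nat \<Rightarrow> arrow)) set" where
  "pat_set n m ks = {(a, d). (\<forall>i j. \<not> in_tri n i j \<longrightarrow> a i j = 0 \<and> d i j = NoArr) \<and>
     (\<forall>i j. in_tri n i j \<longrightarrow> 0 \<le> a i j \<and> a i j \<le> int m) \<and> row_list n a = ks \<and> is_arrowed_GT n a d}"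

definition row_ok :: "int list \<Rightarrow> arrow list \<Rightarrow> int list \<Rightarrow> nat \<Rightarrow> bool" where
  "row_ok ks us ls n \<longleftrightarrow> (\<forall>j<n. entry_ok (ks ! j) (ks ! Suc j) (us ! j) (us ! Suc j) (ls ! j))"

text \<open>Sortedness supplies the hypothesis of \<open>signed_ind_entry\<close>; one inadmissible
  upper entry makes the whole product vanish.\<close>

lemma prod_signed_ind_row:
  assumes "sorted ks" "length ks = Suc n"
  shows "(\<Prod>j<n. signed_ind (ks ! j + ne_shift (us ! j)) (ks ! Suc j - nw_shift (us ! Suc j)) (ls ! j)) =
    (if row_ok ks us ls n then sgn_row ks us ls n else 0)"
proof -
  have "signed_ind (ks ! j + ne_shift (us ! j)) (ks ! Suc j - nw_shift (us ! Suc j)) (ls ! j) =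
     (if entry_ok (ks ! j) (ks ! Suc j) (us ! j) (us ! Suc j) (ls ! j)
      then (if special (ks ! j) (ks ! Suc j) (us ! j) (us ! Suc j) (ls ! j) then -1 else 1) else 0)" if "j < n" for j
    using assms that by (intro signed_ind_entry sorted_nth_mono) auto
  then have "(\<Prod>j<n. signed_ind (ks ! j + ne_shift (us ! j)) (ks ! Suc j - nw_shift (us ! Suc j)) (ls ! j)) =
    (\<Prod>j<n. if entry_ok (ks ! j) (ks ! Suc j) (us ! j) (us ! Suc j) (ls ! j)
      then (if special (ks ! j) (ks ! Suc j) (us ! j) (us ! Suc j) (ls ! j) then -1 else 1) else 0)"
    by (intro prod.cong) auto
  also have "\<dots> = (if row_ok ks us ls n then sgn_row ks us ls n else 0)"
  proof (cases "row_ok ks us ls n")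
    case True
    then show ?thesis unfolding sgn_row_def row_ok_def by (auto intro!: prod.cong)
  next
    case False
    then obtain j where "j < n" "\<not> entry_ok (ks ! j) (ks ! Suc j) (us ! j) (us ! Suc j) (ls ! j)"
      by (auto simp: row_ok_def)
    then show ?thesis using False by (auto intro!: prod_zero bexI[of _ j])
  qed
  finally show ?thesis .
qed

text \<open>Consecutive upper entries are separated by a lower one. This lets the induction on the
  rows continue upwards.\<close>

lemma row_ok_sorted:
  assumes "row_ok ks us ls n" "length ls = n"
  shows "sorted ls"
proof (rule sorted_iff_nth_Suc[THEN iffD2], intro allI impI)
  fix j assume "Suc j < length ls"
  then have "ls ! j \<le> ks ! Suc j" "ks ! Suc j \<le> ls ! Suc j"
    using assms(2) entry_okD(2)[OF assms(1)[unfolded row_ok_def, rule_format, of j]]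
      entry_okD(1)[OF assms(1)[unfolded row_ok_def, rule_format, of "Suc j"]] by auto
  then show "ls ! j \<le> ls ! Suc j" by simp
qed

text \<open>A pattern with prescribed bottom row amounts to the arrows of that row, the row above
  it, and a pattern ending in that upper row.\<close>

lemma pat_set_Suc_bij:
  assumes "length ks = Suc n" "set ks \<subseteq> {0..int m}"
  defines "B \<equiv> (SIGMA us:arrow_lists (Suc n). SIGMA ls:box_lists (int m) n. {ad \<in> pat_set n m ls. row_ok ks us ls n})"
  defines "f \<equiv> \<lambda>(a, d). (row_list (Suc n) d, row_list n a, restrict_rows 0 n a, restrict_rows NoArr n d)"
  defines "g \<equiv> \<lambda>(us, ls :: int list, a, d). (extend_row n ks a, extend_row n us d)"
  shows "x \<in> pat_set (Suc n) m ks \<Longrightarrow> g (f x) = x" "x \<in> pat_set (Suc n) m ks \<Longrightarrow> f x \<in> B"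
    "y \<in> B \<Longrightarrow> f (g y) = y" "y \<in> B \<Longrightarrow> g y \<in> pat_set (Suc n) m ks"
proof -
  show "g (f x) = x" if "x \<in> pat_set (Suc n) m ks"
    using that by (auto simp: f_def g_def pat_set_def extend_restrict_rows)
  show "f x \<in> B" if "x \<in> pat_set (Suc n) m ks"
  proof -
    obtain a d where x: "x = (a, d)" by (cases x)
    have ad: "\<forall>i j. in_tri (Suc n) i j \<longrightarrow> 0 \<le> a i j \<and> a i j \<le> int m" "row_list (Suc n) a = ks" "is_arrowed_GT (Suc n) a d"
      using that by (auto simp: x pat_set_def)
    have "is_arrowed_GT n (restrict_rows 0 n a) (restrict_rows NoArr n d) \<longleftrightarrow> is_arrowed_GT n a d"
      by (rule is_arrowed_GT_cong) (auto simp: restrict_rows_def)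
    moreover have "row_list n (restrict_rows 0 n a) = row_list n a"
      by (rule nth_equalityI) (auto simp: restrict_rows_def in_tri_def)
    ultimately have "(restrict_rows 0 n a, restrict_rows NoArr n d) \<in> pat_set n m (row_list n a)"
      using ad by (auto simp: pat_set_def is_arrowed_GT_Suc restrict_rows_def in_tri_Suc)
    moreover have "set (row_list n a) \<subseteq> {0..int m}"
      using ad(1) by (auto simp: set_row_list in_tri_def)
    ultimately show ?thesis
      using ad(2,3) by (simp add: x f_def B_def is_arrowed_GT_Suc row_ok_def)
  qed
  show "f (g y) = y" if "y \<in> B"
    using that by (auto simp: f_def g_def B_def pat_set_def restrict_extend_row row_list_extend row_list_extend_lower)
  show "g y \<in> pat_set (Suc n) m ks" if "y \<in> B"
  proof -
    obtain us ls a d where y: "y = (us, ls, a, d)" by (cases y)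
    have us: "length us = Suc n" and ls: "length ls = n" "row_ok ks us ls n" and ad: "(a, d) \<in> pat_set n m ls"
      using that by (auto simp: y B_def)
    have "is_arrowed_GT n (extend_row n ks a) (extend_row n us d) \<longleftrightarrow> is_arrowed_GT n a d"
      by (rule is_arrowed_GT_cong) (auto simp: extend_row_def in_tri_def)
    then have 1: "is_arrowed_GT (Suc n) (extend_row n ks a) (extend_row n us d)"
      using ad ls us assms(1) unfolding is_arrowed_GT_Suc row_list_extend[OF us] row_list_extend[OF assms(1)] row_list_extend_lower
      by (auto simp: pat_set_def row_ok_def)
    have 2: "0 \<le> extend_row n ks a i j \<and> extend_row n ks a i j \<le> int m" if "in_tri (Suc n) i j" for i j
    proof (cases "i = Suc n")
      case True
      then have "j - 1 < length ks" using that assms(1) by (auto simp: in_tri_def)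
      then have "ks ! (j - 1) \<in> {0..int m}" using assms(2) nth_mem by blast
      then show ?thesis using True that by (simp add: extend_row_def)
    next
      case False
      then show ?thesis using that ad by (auto simp: extend_row_def pat_set_def in_tri_Suc)
    qed
    have 3: "extend_row n ks a i j = 0 \<and> extend_row n us d i j = NoArr" if "\<not> in_tri (Suc n) i j" for i j
      using that ad by (auto simp: extend_row_def pat_set_def in_tri_Suc)
    show ?thesis
      using 1 2 3 by (simp add: y g_def pat_set_def row_list_extend[OF assms(1)])
  qed
qed

text \<open>The signs of the last row are the coefficients in \<open>row_step_expand\<close>.
  Finiteness is carried through the induction because the nested sums rely on it.\<close>

lemma sum_pat_set:
  assumes "length ks = n" "sorted ks" "set ks \<subseteq> {0..int m}"
  shows "finite (pat_set n m ks) \<and> (\<Sum>(a, d)\<in>pat_set n m ks. agt_wt n a d) = agt_gf (replicate n 1) ks"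
  using assms
proof (induction n arbitrary: ks)
  case 0
  have "pat_set 0 m ks = {(\<lambda>i j. 0, \<lambda>i j. NoArr)}"
    using 0 by (auto simp: pat_set_def in_tri_def row_list_def is_arrowed_GT_iff fun_eq_iff)
  then show ?case by (simp add: agt_wt_def)
next
  case (Suc n)
  let ?B = "\<lambda>us. SIGMA ls:box_lists (int m) n. {ad \<in> pat_set n m ls. row_ok ks us ls n}"
  have fin_us: "finite (arrow_lists (Suc n))" by (rule finite_lists_length_eq) simp
  have fin_ls: "finite (box_lists (int m) n)" by (rule finite_lists_length_eq) simp
  \<comment> \<open>The hypothesis is available only for sorted \<open>ls\<close>, which
    admissibility provides; inadmissible upper rows have coefficient 0.\<close>
  have IH: "finite (pat_set n m ls)" "(\<Sum>(a, d)\<in>pat_set n m ls. agt_wt n a d) = agt_gf (replicate n 1) ls"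
    if "row_ok ks us ls n" "ls \<in> box_lists (int m) n" for us ls
    using Suc.IH[of ls] row_ok_sorted[OF that(1)] that(2) by auto
  have fin_ad: "finite {ad \<in> pat_set n m ls. row_ok ks us ls n}" if "ls \<in> box_lists (int m) n" for us ls
    using IH(1)[OF _ that] by (cases "row_ok ks us ls n") auto
  have fin_B: "finite (?B us)" for us
    using fin_ls fin_ad by (rule finite_SigmaI)
  note bij = pat_set_Suc_bij[OF Suc.prems(1,3)]
  let ?g = "\<lambda>(us, ls :: int list, a, d). (extend_row n ks a, extend_row n us d)"
  have "pat_set (Suc n) m ks \<subseteq> ?g ` (Sigma (arrow_lists (Suc n)) ?B)"
    using bij(1,2) by (metis (no_types, lifting) image_eqI subsetI)
  then have fin: "finite (pat_set (Suc n) m ks)"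
    using fin_us fin_B by (auto intro: finite_subset)
  have "(\<Sum>(a, d)\<in>pat_set (Suc n) m ks. agt_wt (Suc n) a d) =
    (\<Sum>(us, ls, a, d)\<in>Sigma (arrow_lists (Suc n)) ?B. (\<Prod>j\<le>n. arrow_wt (us ! j)) * sgn_row ks us ls n * agt_wt n a d)"
  proof (rule sum.reindex_bij_witness[OF bij])
    fix x assume "x \<in> pat_set (Suc n) m ks"
    then obtain a d where x: "x = (a, d)" "row_list (Suc n) a = ks" by (cases x) (auto simp: pat_set_def)
    have "agt_wt n (restrict_rows 0 n a) (restrict_rows NoArr n d) = agt_wt n a d"
      by (rule agt_wt_cong) (auto simp: restrict_rows_def)
    then show "(case case x of (a, d) \<Rightarrow> (row_list (Suc n) d, row_list n a, restrict_rows 0 n a, restrict_rows NoArr n d) of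
        (us, ls, a, d) \<Rightarrow> (\<Prod>j\<le>n. arrow_wt (us ! j)) * sgn_row ks us ls n * agt_wt n a d) = (case x of (a, d) \<Rightarrow> agt_wt (Suc n) a d)"
      by (simp add: x(1) agt_wt_Suc x(2)[symmetric] del: nth_row_list)
  qed
  also have "\<dots> = (\<Sum>us\<in>arrow_lists (Suc n). \<Sum>ls\<in>box_lists (int m) n. \<Sum>(a, d)\<in>{ad \<in> pat_set n m ls. row_ok ks us ls n}.
      (\<Prod>j\<le>n. arrow_wt (us ! j)) * sgn_row ks us ls n * agt_wt n a d)"
  proof -
    let ?F = "\<lambda>us ls (a, d). (\<Prod>j\<le>n. arrow_wt (us ! j)) * sgn_row ks us ls n * agt_wt n a d"
    have "(\<Sum>(us, x)\<in>Sigma (arrow_lists (Suc n)) ?B. case x of (ls, ad) \<Rightarrow> ?F us ls ad) =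
      (\<Sum>us\<in>arrow_lists (Suc n). \<Sum>(ls, ad)\<in>?B us. ?F us ls ad)"
      using fin_us fin_B by (intro sum.Sigma[symmetric]) auto
    also have "\<dots> = (\<Sum>us\<in>arrow_lists (Suc n). \<Sum>ls\<in>box_lists (int m) n. \<Sum>ad\<in>{ad \<in> pat_set n m ls. row_ok ks us ls n}. ?F us ls ad)"
      using fin_ls fin_ad by (intro sum.cong refl sum.Sigma[symmetric]) auto
    finally show ?thesis .
  qed
  also have "\<dots> = (\<Sum>us\<in>arrow_lists (Suc n). \<Sum>ls\<in>box_lists (int m) n.
     (\<Prod>j\<le>n. arrow_wt (us ! j)) * (\<Prod>j<n. signed_ind (ks ! j + ne_shift (us ! j)) (ks ! Suc j - nw_shift (us ! Suc j)) (ls ! j)) * agt_gf (replicate n 1) ls)"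
  proof (intro sum.cong refl)
    fix us ls assume ls: "ls \<in> box_lists (int m) n"
    show "(\<Sum>(a, d)\<in>{ad \<in> pat_set n m ls. row_ok ks us ls n}. (\<Prod>j\<le>n. arrow_wt (us ! j)) * sgn_row ks us ls n * agt_wt n a d) =
      (\<Prod>j\<le>n. arrow_wt (us ! j)) * (\<Prod>j<n. signed_ind (ks ! j + ne_shift (us ! j)) (ks ! Suc j - nw_shift (us ! Suc j)) (ls ! j)) * agt_gf (replicate n 1) ls"
      unfolding prod_signed_ind_row[OF Suc.prems(2,1)]
      using IH(2)[OF _ ls, of us] by (cases "row_ok ks us ls n") (simp_all add: split_def sum_distrib_left[symmetric])
  qed
  also have "\<dots> = agt_gf (replicate (Suc n) 1) ks"
    using row_step_expand[OF Suc.prems(1,3)] by simp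
  finally show ?case using fin by blast
qed

section \<open>Summing over all strictly increasing bottom rows\<close>

lemma strict_lists_empty: "N < n \<Longrightarrow> strict_lists n N = {}"
proof (rule ccontr)
  assume "N < n" "strict_lists n N \<noteq> {}"
  then obtain ks where ks: "length ks = n" "sorted_wrt (<) ks" "set ks \<subseteq> {0..<int N}"
    by (auto simp: strict_lists_def)
  have "n = card (set ks)" using ks strict_sorted_iff distinct_card by metis
  also have "\<dots> \<le> N" using card_mono[OF _ ks(3)] by simp
  finally show False using \<open>N < n\<close> by simp
qed

lemma AGT_set_eq: "AGT_set n m = (\<Union>ks\<in>strict_lists n (Suc m). pat_set n m ks)"
proof (intro equalityI subsetI)
  fix x assume "x \<in> AGT_set n m"
  then obtain a d where x: "x = (a, d)" and ad: "(a, d) \<in> AGT_set n m" by (cases x) auto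
  have "sorted_wrt (<) (row_list n a)"
    using ad by (subst sorted_wrt_iff_nth_Suc_transp) (auto simp: AGT_set_def)
  moreover have "set (row_list n a) \<subseteq> {0..<int (Suc m)}"
    using ad by (fastforce simp: AGT_set_def set_row_list in_tri_def)
  ultimately have "row_list n a \<in> strict_lists n (Suc m)" by (simp add: strict_lists_def)
  moreover have "(a, d) \<in> pat_set n m (row_list n a)" using ad by (simp add: AGT_set_def pat_set_def)
  ultimately show "x \<in> (\<Union>ks\<in>strict_lists n (Suc m). pat_set n m ks)" unfolding x by blast
next
  fix x assume "x \<in> (\<Union>ks\<in>strict_lists n (Suc m). pat_set n m ks)"
  then obtain a d where x: "x = (a, d)" "row_list n a \<in> strict_lists n (Suc m)" "(a, d) \<in> pat_set n m (row_list n a)"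
    by (auto simp: pat_set_def)
  have "a n j < a n (j + 1)" if "1 \<le> j" "j < n" for j
    using x(2) that sorted_wrt_nth_less[of "(<)" "row_list n a" "j - 1" j] by (auto simp: strict_lists_def)
  then show "x \<in> AGT_set n m" using x(3) by (auto simp: x(1) AGT_set_def pat_set_def)
qed

lemma sum_AGT_set:
  "real_of_int (\<Sum>(a, d)\<in>AGT_set n m. sgn_AGT n a d * (-1) ^ card (double_arrows n d)) =
    (\<Sum>ks\<in>strict_lists n (Suc m). agt_gf (replicate n 1) ks)"
proof -
  have pat: "finite (pat_set n m ks)" "(\<Sum>(a, d)\<in>pat_set n m ks. agt_wt n a d) = agt_gf (replicate n 1) ks"
    if "ks \<in> strict_lists n (Suc m)" for ks
  proof -
    have "sorted ks" "length ks = n" "set ks \<subseteq> {0..int m}"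
      using that by (auto simp: strict_lists_def strict_sorted_iff)
    then show "finite (pat_set n m ks)" "(\<Sum>(a, d)\<in>pat_set n m ks. agt_wt n a d) = agt_gf (replicate n 1) ks"
      using sum_pat_set[of ks n m] by auto
  qed
  have "real_of_int (\<Sum>(a, d)\<in>AGT_set n m. sgn_AGT n a d * (-1) ^ card (double_arrows n d)) =
    (\<Sum>(a, d)\<in>AGT_set n m. agt_wt n a d)"
    unfolding of_int_sum by (intro sum.cong refl) (simp add: split_def agt_wt_eq[symmetric])
  also have "\<dots> = (\<Sum>ks\<in>strict_lists n (Suc m). \<Sum>(a, d)\<in>pat_set n m ks. agt_wt n a d)"
    unfolding AGT_set_eq using pat(1) by (intro sum.UNION_disjoint) (auto simp: pat_set_def)
  also have "\<dots> = (\<Sum>ks\<in>strict_lists n (Suc m). agt_gf (replicate n 1) ks)"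
    using pat(2) by (intro sum.cong) auto
  finally show ?thesis .
qed

theorem theorem1p1:
  fixes n m :: nat
  assumes "n \<ge> 1"
  shows "real_of_int (\<Sum>(a, d)\<in>AGT_set n m.
            sgn_AGT n a d * (-1) ^ card (double_arrows n d))
         = 2 ^ n * (\<Prod>i=1..n.
             pochhammer (real m - real n + 3 * real i + 1) (i - 1)
               * pochhammer (real m - real n + real i + 1) i
             / (pochhammer ((real m - real n + real i + 2) / 2) (i - 1)
               * pochhammer (real i) i))"
proof (cases "Suc m < n")
  case True
  \<comment> \<open>More than \<open>m + 1\<close> distinct entries do not fit, so the sum is empty.
    At this index the second Pochhammer symbol starts at 0, so the product vanishes too.\<close>
  let ?i = "n - m - 1"
  have i: "?i \<in> {1..n}" "real m - real n + real ?i + 1 = 0" "?i > 0"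
    using True by (auto simp: of_nat_diff)
  have "(\<Prod>i=1..n. pochhammer (real m - real n + 3 * real i + 1) (i - 1) * pochhammer (real m - real n + real i + 1) i
             / (pochhammer ((real m - real n + real i + 2) / 2) (i - 1) * pochhammer (real i) i)) = 0"
    by (rule prod_zero[OF _ bexI[OF _ i(1)]]) (use i in \<open>simp_all add: pochhammer_0_left\<close>)
  then show ?thesis unfolding sum_AGT_set strict_lists_empty[OF True] by simp
next
  case False
  \<comment> \<open>The box has \<open>N = m + 1\<close> values, and \<open>sum_agt_gf\<close>
    requires \<open>M + n = N + 1\<close>; the case assumption ensures
    \<open>M \<ge> 1\<close>.\<close>
  define M where "M = m + 2 - n"
  have M: "M \<ge> 1" "M + n = Suc m + 1" "real M = real m - real n + 2" using False by (auto simp: M_def of_nat_diff)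
  show ?thesis
    unfolding sum_AGT_set sum_agt_gf[OF M(2)] ballot_det_eq[OF M(1)] M(3)
    by (simp add: algebra_simps)
qed

end
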